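(* Suppose that $D\subsetneq \mathbb{R}^n$ is a $\varphi$-uniform domain and $x_0\in D$. Let $\{x_i\}_{i=1}^{\infty}$ be a sequence of points in $B^n(x_0,\delta_D(x_0))$ satisfying $x_i\in[x_0,x_{i-1})$ (for $i\ge 2$) and $|x_0-x_i|=\frac{1}{2^{i+2}}\delta_D(x_0)$. Let $B_i$, $i=1,2,\ldots$, be disjoint balls with centers $x_i$ and radii $r_i$, and for a fixed $c\in(0,1)$ let $E_i\subset B^n(x_i,c r_i)$ be closed sets whose complements with respect to $\mathbb{R}^n$ are $\psi$-uniform and which satisfy $x_i\in E_i$. Denote $F=\bigcup_{i=1}^\infty E_i\cup\{x_0\}$. Then $D\setminus F$ is $\varphi_3$-uniform with $\varphi_3$ depending on $\varphi$ and $\psi$.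
   Context: Throughout $n\ge 2$; a domain is an open connected non-empty subset of $\mathbb{R}^n$. $B^n(x,r)$ is the open Euclidean ball with center $x$ and radius $r$; $[a,b)$ is the half-open Euclidean segment from $a$ to $b$ (containing $a$, not $b$). For a domain $G\subsetneq\mathbb{R}^n$ and $x\in G$, $\delta_G(x)$ is the Euclidean distance from $x$ to $\partial G$. The quasihyperbolic metric of $G$ is $k_G(x,y)=\inf_{\gamma}\int_\gamma \frac{|dz|}{\delta_G(z)}$, the infimum being over all rectifiable paths $\gamma\subset G$ joining $x$ and $y$. For a homeomorphism $\varphi:[0,\infty)\to[0,\infty)$, a domain $G\subsetneq\mathbb{R}^n$ is called $\varphi$-uniform if $k_G(x,y)\le \varphi\big(|x-y|/\min\{\delta_G(x),\delta_G(y)\}\big)$ for all $x,y\in G$ (and similarly for the homeomorphisms $\psi$, $\varphi_3$ of $[0,\infty)$). *)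

theory Defs
  imports "HOL-Analysis.Analysis"
begin

definition domain :: "'a::euclidean_space set \<Rightarrow> bool" where
  "domain G \<longleftrightarrow> open G \<and> connected G \<and> G \<noteq> {}"

definition bdist :: "'a::euclidean_space set \<Rightarrow> 'a \<Rightarrow> real" where
  "bdist G x = infdist x (frontier G)"

definition variation_sums :: "(real \<Rightarrow> 'a::euclidean_space) \<Rightarrow> real \<Rightarrow> real \<Rightarrow> real set" where
  "variation_sums \<gamma> a b =
     {\<Sum>i<m. dist (\<gamma> (t i)) (\<gamma> (t (Suc i))) | (m::nat) (t::nat \<Rightarrow> real).
        (\<forall>i\<le>m. t i \<in> {a..b}) \<and> (\<forall>i<m. t i \<le> t (Suc i))}"

definition arc_length :: "(real \<Rightarrow> 'a::euclidean_space) \<Rightarrow> real \<Rightarrow> real \<Rightarrow> real" where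
  "arc_length \<gamma> a b = Sup (variation_sums \<gamma> a b)"

definition rectifiable_path :: "(real \<Rightarrow> 'a::euclidean_space) \<Rightarrow> bool" where
  "rectifiable_path \<gamma> \<longleftrightarrow> path \<gamma> \<and> bdd_above (variation_sums \<gamma> 0 1)"

text \<open>Parametrization by arc length. The value does not depend on the chosen parameter, since
  a rectifiable path is constant on every interval on which its length function is constant.\<close>

definition arc_param :: "(real \<Rightarrow> 'a::euclidean_space) \<Rightarrow> real \<Rightarrow> 'a" where
  "arc_param \<gamma> s = \<gamma> (SOME t. t \<in> {0..1} \<and> arc_length \<gamma> 0 t = s)"

definition line_integral :: "('a::euclidean_space \<Rightarrow> real) \<Rightarrow> (real \<Rightarrow> 'a) \<Rightarrow> real" where
  "line_integral f \<gamma> = integral {0..arc_length \<gamma> 0 1} (\<lambda>s. f (arc_param \<gamma> s))"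

definition qh_metric :: "'a::euclidean_space set \<Rightarrow> 'a \<Rightarrow> 'a \<Rightarrow> real" where
  "qh_metric G x y =
     Inf {line_integral (\<lambda>z. 1 / bdist G z) \<gamma> | \<gamma>.
            rectifiable_path \<gamma> \<and> path_image \<gamma> \<subseteq> G \<and> pathstart \<gamma> = x \<and> pathfinish \<gamma> = y}"

definition halfline_homeo :: "(real \<Rightarrow> real) \<Rightarrow> bool" where
  "halfline_homeo \<phi> \<longleftrightarrow> (\<exists>\<theta>. homeomorphism {0..} {0..} \<phi> \<theta>)"

definition uniform_domain :: "(real \<Rightarrow> real) \<Rightarrow> 'a::euclidean_space set \<Rightarrow> bool" where
  "uniform_domain \<phi> G \<longleftrightarrow> domain G \<and> G \<noteq> UNIV \<and>
     (\<forall>x\<in>G. \<forall>y\<in>G. qh_metric G x y \<le> \<phi> (dist x y / min (bdist G x) (bdist G y)))"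

definition half_open_segment :: "'a::euclidean_space \<Rightarrow> 'a \<Rightarrow> 'a set" where
  "half_open_segment a b = closed_segment a b - {b}"

end

theory Submission
  imports Defs
begin

text \<open>
  Up to constants, \<open>k\<^sub>G(x, y)\<close> is the least number of steps in a chain from \<open>x\<close> to \<open>y\<close> in which each
  step is at most half the distance of its endpoints to the complement of \<open>G\<close>.  So \<open>\<phi>\<close>-uniformity for
  some \<open>\<phi>\<close> means that the length of the chains is controlled by \<open>|x - y| / min (\<delta>\<^sub>G(x), \<delta>\<^sub>G(y))\<close>; small
  values of this ratio are handled by segments.

  Chains survive the removal of sets \<open>E\<^sub>i\<close> lying well inside separated balls \<open>H\<^sub>i\<close>.  A chain of \<open>D\<close>
  between points outside the \<open>H\<^sub>i\<close> is pushed radially to the spheres bounding the \<open>H\<^sub>i\<close>; a step inside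
  \<open>H\<^sub>i\<close> is replaced by a bounded number of steps along the sphere, which is connected since \<open>n \<ge> 2\<close>.  In
  the same way a chain of the complement of \<open>E\<^sub>i\<close> is pushed into \<open>H\<^sub>i\<close>.  Points inside and outside are
  linked through the point where the segment between them leaves \<open>H\<^sub>i\<close>.  This is applied first to the
  set \<open>{x\<^sub>0}\<close>, and then in \<open>D - {x\<^sub>0}\<close> to the sets \<open>E\<^sub>i\<close> with balls about \<open>x\<^sub>i\<close> of radius
  \<open>c r\<^sub>i + \<epsilon> |x\<^sub>i - x\<^sub>0|\<close>.  They are comparable in size to \<open>|x\<^sub>i - x\<^sub>0|\<close> even if \<open>r\<^sub>i\<close> is tiny, and disjointness
  of the \<open>B\<^sub>i\<close> separates them if \<open>\<epsilon>\<close> is small compared with \<open>1 - c\<close>.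
\<close>

section \<open>Arc length\<close>

lemma variation_sums_iff:
  "v \<in> variation_sums \<gamma> a b \<longleftrightarrow>
     (\<exists>m t. v = (\<Sum>i<m. dist (\<gamma> (t i)) (\<gamma> (t (Suc i)))) \<and>
        (\<forall>i\<le>m. a \<le> t i \<and> t i \<le> b) \<and> (\<forall>i<m. t i \<le> t (Suc i)))"
  unfolding variation_sums_def by auto

lemma variation_sums_nonempty:
  assumes "a \<le> b" shows "variation_sums \<gamma> a b \<noteq> {}"
proof -
  have "0 \<in> variation_sums \<gamma> a b"
    unfolding variation_sums_iff using assms by (intro exI[of _ 0] exI[of _ "\<lambda>_. a"]) auto
  then show ?thesis by blast
qed

text \<open>A monotone \<open>h\<close> maps partitions to partitions with the same increments.
  Enlarging the interval and the affine changes of parameter on the halves of a joined path are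
  instances; applied in both directions it gives equality.\<close>

lemma variation_sums_reparam:
  assumes "mono_on {a..b} h" "h ` {a..b} \<subseteq> {a'..b'}" "\<And>x. x \<in> {a..b} \<Longrightarrow> \<gamma> x = \<gamma>' (h x)"
  shows "variation_sums \<gamma> a b \<subseteq> variation_sums \<gamma>' a' b'"
proof
  fix v assume "v \<in> variation_sums \<gamma> a b"
  then obtain m t where v: "v = (\<Sum>i<m. dist (\<gamma> (t i)) (\<gamma> (t (Suc i))))"
    and t: "\<forall>i\<le>m. t i \<in> {a..b}" "\<forall>i<m. t i \<le> t (Suc i)"
    unfolding variation_sums_iff by auto
  have "v = (\<Sum>i<m. dist (\<gamma>' (h (t i))) (\<gamma>' (h (t (Suc i)))))"
    unfolding v using t(1) assms(3) by (intro sum.cong) auto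
  moreover have "\<forall>i\<le>m. h (t i) \<in> {a'..b'}" using t(1) assms(2) by blast
  moreover have "\<forall>i<m. h (t i) \<le> h (t (Suc i))"
    using t by (intro allI impI mono_onD[OF assms(1)]) (use t in \<open>auto simp del: atLeastAtMost_iff\<close>)
  ultimately show "v \<in> variation_sums \<gamma>' a' b'"
    unfolding variation_sums_iff by (intro exI[of _ m] exI[of _ "\<lambda>i. h (t i)"]) auto
qed

lemma variation_sums_mono:
  assumes "a' \<le> a" "b \<le> b'"
  shows "variation_sums \<gamma> a b \<subseteq> variation_sums \<gamma> a' b'"
  by (rule variation_sums_reparam[where h = "\<lambda>x. x"]) (use assms in \<open>auto intro: mono_onI\<close>)

text \<open>Truncation by \<open>min\<close> and \<open>max\<close> cuts a partition interval at
  \<open>b\<close> wherever \<open>b\<close> lies, so that no point has to be inserted into a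
  partition. Only an interval that straddles \<open>b\<close> uses the triangle inequality.\<close>

lemma dist_split_min_max:
  fixes \<gamma> :: "real \<Rightarrow> 'a::metric_space"
  assumes "x \<le> y"
  shows "dist (\<gamma> x) (\<gamma> y) \<le> dist (\<gamma> (min x b)) (\<gamma> (min y b)) + dist (\<gamma> (max x b)) (\<gamma> (max y b))"
proof -
  consider "y \<le> b" | "x \<le> b" "b \<le> y" | "b \<le> x" by linarith
  then show ?thesis
  proof cases
    case 2 then show ?thesis using dist_triangle[of "\<gamma> x" "\<gamma> y" "\<gamma> b"] by (auto simp: min_def max_def)
  qed (use assms in \<open>auto simp: min_def max_def\<close>)
qed

lemma variation_sums_le_add:
  assumes "v \<in> variation_sums \<gamma> a c" "a \<le> b" "b \<le> c"
  shows "\<exists>v1\<in>variation_sums \<gamma> a b. \<exists>v2\<in>variation_sums \<gamma> b c. v \<le> v1 + v2"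
proof -
  obtain m t where v: "v = (\<Sum>i<m. dist (\<gamma> (t i)) (\<gamma> (t (Suc i))))"
    and t: "\<forall>i\<le>m. a \<le> t i \<and> t i \<le> c" "\<forall>i<m. t i \<le> t (Suc i)"
    using assms(1) unfolding variation_sums_iff by auto
  define v1 where "v1 = (\<Sum>i<m. dist (\<gamma> (min (t i) b)) (\<gamma> (min (t (Suc i)) b)))"
  define v2 where "v2 = (\<Sum>i<m. dist (\<gamma> (max (t i) b)) (\<gamma> (max (t (Suc i)) b)))"
  have "v1 \<in> variation_sums \<gamma> a b" unfolding variation_sums_iff v1_def
    by (intro exI[of _ m] exI[of _ "\<lambda>i. min (t i) b"]) (use t assms in auto)
  moreover have "v2 \<in> variation_sums \<gamma> b c" unfolding variation_sums_iff v2_def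
    by (intro exI[of _ m] exI[of _ "\<lambda>i. max (t i) b"]) (use t assms in auto)
  moreover have "v \<le> v1 + v2"
    unfolding v v1_def v2_def sum.distrib[symmetric]
    using t(2) by (intro sum_mono dist_split_min_max) auto
  ultimately show ?thesis by blast
qed

lemma sum_lessThan_add: "(\<Sum>i<m+n. f i) = (\<Sum>i<m. f i) + (\<Sum>i<n. f (m + i))" for f :: "nat \<Rightarrow> real"
  by (induction n) auto

lemma variation_sums_add_le:
  assumes "v1 \<in> variation_sums \<gamma> a b" "v2 \<in> variation_sums \<gamma> b c" "a \<le> b" "b \<le> c"
  shows "\<exists>v\<in>variation_sums \<gamma> a c. v1 + v2 \<le> v"
proof -
  obtain m t where v1: "v1 = (\<Sum>i<m. dist (\<gamma> (t i)) (\<gamma> (t (Suc i))))"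
    and t: "\<forall>i\<le>m. a \<le> t i \<and> t i \<le> b" "\<forall>i<m. t i \<le> t (Suc i)"
    using assms(1) unfolding variation_sums_iff by auto
  obtain k u where v2: "v2 = (\<Sum>i<k. dist (\<gamma> (u i)) (\<gamma> (u (Suc i))))"
    and u: "\<forall>i\<le>k. b \<le> u i \<and> u i \<le> c" "\<forall>i<k. u i \<le> u (Suc i)"
    using assms(2) unfolding variation_sums_iff by auto
  \<comment> \<open>The partitions are listed one after the other: \<open>w m = t m\<close> and
    \<open>w (Suc m) = u 0\<close>, so there are \<open>Suc m + k\<close> increments. The extra one
    from \<open>t m\<close> to \<open>u 0\<close> is nonnegative and is dropped.\<close>
  define w where "w i = (if i \<le> m then t i else u (i - Suc m))" for i
  have w: "\<forall>i\<le>Suc m + k. a \<le> w i \<and> w i \<le> c"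
  proof (intro allI impI)
    fix i assume "i \<le> Suc m + k"
    then have "i - Suc m \<le> k" by simp
    then show "a \<le> w i \<and> w i \<le> c"
      using t(1) u(1) assms(3,4) unfolding w_def by (smt (verit))
  qed
  have w': "\<forall>i<Suc m + k. w i \<le> w (Suc i)"
  proof (intro allI impI)
    fix i assume i: "i < Suc m + k"
    consider "i < m" | "i = m" | j where "i = Suc m + j" "j < k"
      using i by (metis add_less_cancel_left le_add_diff_inverse less_Suc_eq linorder_not_less)
    then show "w i \<le> w (Suc i)"
    proof cases
      case 2
      then have "t m \<le> b" "b \<le> u 0" using t(1) u(1) by auto
      then show ?thesis using 2 unfolding w_def by auto
    qed (use t(2) u(2) in \<open>auto simp: w_def\<close>)
  qed
  let ?v = "\<Sum>i<Suc m + k. dist (\<gamma> (w i)) (\<gamma> (w (Suc i)))"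
  have "?v = (\<Sum>i<m. dist (\<gamma> (w i)) (\<gamma> (w (Suc i)))) + dist (\<gamma> (w m)) (\<gamma> (w (Suc m))) +
     (\<Sum>i<k. dist (\<gamma> (w (Suc m + i))) (\<gamma> (w (Suc (Suc m + i)))))"
    unfolding sum_lessThan_add by simp
  moreover have "(\<Sum>i<m. dist (\<gamma> (w i)) (\<gamma> (w (Suc i)))) = v1"
    unfolding v1 by (intro sum.cong) (auto simp: w_def)
  moreover have "(\<Sum>i<k. dist (\<gamma> (w (Suc m + i))) (\<gamma> (w (Suc (Suc m + i))))) = v2"
    unfolding v2 by (intro sum.cong) (auto simp: w_def)
  ultimately have "v1 + v2 \<le> ?v" by simp
  moreover have "?v \<in> variation_sums \<gamma> a c"
    unfolding variation_sums_iff using w w' by (intro exI[of _ "Suc m + k"] exI[of _ w]) auto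
  ultimately show ?thesis by blast
qed

text \<open>Cutting a partition at \<open>b\<close> gives one inequality, concatenating partitions
  the other; boundedness on \<open>{a..c}\<close> makes all three suprema meaningful.\<close>

lemma arc_length_add:
  assumes bdd: "bdd_above (variation_sums \<gamma> a c)" and ab: "a \<le> b" "b \<le> c"
  shows "arc_length \<gamma> a c = arc_length \<gamma> a b + arc_length \<gamma> b c"
proof (rule antisym)
  have bdd1: "bdd_above (variation_sums \<gamma> a b)" "bdd_above (variation_sums \<gamma> b c)"
    using bdd variation_sums_mono ab by (meson bdd_above_mono order_refl)+
  have ne: "variation_sums \<gamma> a b \<noteq> {}" "variation_sums \<gamma> b c \<noteq> {}" "variation_sums \<gamma> a c \<noteq> {}"
    using ab by (auto intro!: variation_sums_nonempty simp del: ex_in_conv)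
  show "arc_length \<gamma> a c \<le> arc_length \<gamma> a b + arc_length \<gamma> b c"
    unfolding arc_length_def
  proof (rule cSup_least[OF ne(3)])
    fix v assume "v \<in> variation_sums \<gamma> a c"
    then obtain v1 v2 where "v1 \<in> variation_sums \<gamma> a b" "v2 \<in> variation_sums \<gamma> b c" "v \<le> v1 + v2"
      using variation_sums_le_add ab by blast
    then show "v \<le> Sup (variation_sums \<gamma> a b) + Sup (variation_sums \<gamma> b c)"
      using cSup_upper bdd1 by (smt (verit, best))
  qed
  have *: "v1 + v2 \<le> Sup (variation_sums \<gamma> a c)"
    if v: "v1 \<in> variation_sums \<gamma> a b" "v2 \<in> variation_sums \<gamma> b c" for v1 v2
    using variation_sums_add_le[OF v ab] bdd by (meson cSup_upper order_trans)
  \<comment> \<open>The supremum over pairs is taken in two stages: over \<open>v1\<close> with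
    \<open>v2\<close> fixed, then over \<open>v2\<close>.\<close>
  have "Sup (variation_sums \<gamma> a b) \<le> Sup (variation_sums \<gamma> a c) - v2"
    if "v2 \<in> variation_sums \<gamma> b c" for v2
    using *[OF _ that] by (intro cSup_least[OF ne(1)]) (simp add: le_diff_eq)
  then have "Sup (variation_sums \<gamma> b c) \<le> Sup (variation_sums \<gamma> a c) - Sup (variation_sums \<gamma> a b)"
    by (intro cSup_least[OF ne(2)]) fastforce
  then show "arc_length \<gamma> a b + arc_length \<gamma> b c \<le> arc_length \<gamma> a c"
    unfolding arc_length_def by simp
qed

lemma dist_le_arc_length:
  assumes bdd: "bdd_above (variation_sums \<gamma> a b)" and ab: "a \<le> b"
  shows "dist (\<gamma> a) (\<gamma> b) \<le> arc_length \<gamma> a b"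
proof -
  have "dist (\<gamma> a) (\<gamma> b) \<in> variation_sums \<gamma> a b"
    unfolding variation_sums_iff using ab
    by (intro exI[of _ 1] exI[of _ "\<lambda>i. if i = 0 then a else b"]) auto
  then show ?thesis unfolding arc_length_def by (rule cSup_upper[OF _ bdd])
qed

lemma rectifiable_pathD:
  assumes "rectifiable_path \<gamma>" "0 \<le> a" "b \<le> 1"
  shows "bdd_above (variation_sums \<gamma> a b)"
  using assms variation_sums_mono unfolding rectifiable_path_def by (meson bdd_above_mono)

lemma arc_length_nonneg:
  assumes "rectifiable_path \<gamma>" "0 \<le> a" "a \<le> b" "b \<le> 1"
  shows "0 \<le> arc_length \<gamma> a b"
  using dist_le_arc_length[OF rectifiable_pathD[OF assms(1,2,4)] assms(3)]
  by (meson order_trans zero_le_dist)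

lemma arc_length_diff:
  assumes "rectifiable_path \<gamma>" "0 \<le> a" "a \<le> b" "b \<le> 1"
  shows "arc_length \<gamma> 0 b - arc_length \<gamma> 0 a = arc_length \<gamma> a b"
  using arc_length_add[OF rectifiable_pathD[OF assms(1), of 0 b], of a] assms by auto

lemma arc_length_same [simp]: "arc_length \<gamma> a a = 0"
proof -
  have "v = 0" if vin: "v \<in> variation_sums \<gamma> a a" for v
  proof -
    obtain m t where v: "v = (\<Sum>i<m. dist (\<gamma> (t i)) (\<gamma> (t (Suc i))))"
      and t: "\<forall>i\<le>m. a \<le> t i \<and> t i \<le> a"
      using vin unfolding variation_sums_iff by blast
    have "t i = a" if "i \<le> m" for i using t that by (meson order_antisym)
    then show ?thesis unfolding v by (intro sum.neutral) auto
  qed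
  then have "variation_sums \<gamma> a a = {0}"
    using variation_sums_nonempty[of a a \<gamma>] by blast
  then show ?thesis unfolding arc_length_def by simp
qed

section \<open>Continuity of the length function and parametrization by arc length\<close>

lemma arc_length_continuous:
  assumes "rectifiable_path \<gamma>"
  shows "continuous_on {0..1} (arc_length \<gamma> 0)"
proof -
  have path: "path \<gamma>" and bdd: "bdd_above (variation_sums \<gamma> 0 1)"
    using assms unfolding rectifiable_path_def by auto
  have uc: "uniformly_continuous_on {0..1} \<gamma>"
    using path unfolding path_def by (simp add: compact_uniformly_continuous)
  \<comment> \<open>Length is uniformly small on short intervals: take a partition whose sum misses
    the total length by less than \<open>e/2\<close>. The part of the sum falling in
    \<open>{a..b}\<close> has \<open>m\<close> increments, small by uniform continuity; the rest is
    at most the length of the two outer pieces.\<close>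
  have small: "\<exists>d>0. \<forall>a b. 0 \<le> a \<longrightarrow> a \<le> b \<longrightarrow> b \<le> 1 \<longrightarrow> b - a < d \<longrightarrow> arc_length \<gamma> a b < e"
    if e: "e > 0" for e
  proof -
    obtain v where "v \<in> variation_sums \<gamma> 0 1" and v2: "arc_length \<gamma> 0 1 - e/2 < v"
      using less_cSup_iff[OF variation_sums_nonempty bdd, of "arc_length \<gamma> 0 1 - e/2"] e
      unfolding arc_length_def by auto
    then obtain m t where v: "v = (\<Sum>i<m. dist (\<gamma> (t i)) (\<gamma> (t (Suc i))))"
      and t: "\<forall>i\<le>m. 0 \<le> t i \<and> t i \<le> 1" "\<forall>i<m. t i \<le> t (Suc i)"
      unfolding variation_sums_iff by auto
    \<comment> \<open>\<open>m\<close> increments of size at most \<open>e'\<close> sum to less than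
      \<open>e/2\<close>; the added 1 covers \<open>m = 0\<close>.\<close>
    define e' where "e' = e / (2 * (real m + 1))"
    have "e' > 0" using e unfolding e'_def by simp
    then obtain d where d: "d > 0"
      and dd: "\<And>x y. x \<in> {0..1} \<Longrightarrow> y \<in> {0..1} \<Longrightarrow> dist y x < d \<Longrightarrow> dist (\<gamma> y) (\<gamma> x) < e'"
      using uc unfolding uniformly_continuous_on_def by meson
    have "arc_length \<gamma> a b < e" if ab: "0 \<le> a" "a \<le> b" "b \<le> 1" "b - a < d" for a b
    proof -
      define v1 where "v1 = (\<Sum>i<m. dist (\<gamma> (min (t i) a)) (\<gamma> (min (t (Suc i)) a)))"
      \<comment> \<open>The partition points are clamped to \<open>{a..b}\<close>, so each increment
        is between parameters less than \<open>d\<close> apart.\<close>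
      define v2 where "v2 = (\<Sum>i<m. dist (\<gamma> (min (max (t i) a) b)) (\<gamma> (min (max (t (Suc i)) a) b)))"
      define v3 where "v3 = (\<Sum>i<m. dist (\<gamma> (max (max (t i) a) b)) (\<gamma> (max (max (t (Suc i)) a) b)))"
      have "v1 \<in> variation_sums \<gamma> 0 a" unfolding variation_sums_iff v1_def
        by (intro exI[of _ m] exI[of _ "\<lambda>i. min (t i) a"]) (use t ab in auto)
      then have "v1 \<le> arc_length \<gamma> 0 a" unfolding arc_length_def
        using rectifiable_pathD[OF assms] ab by (intro cSup_upper) auto
      moreover have "v3 \<in> variation_sums \<gamma> b 1" unfolding variation_sums_iff v3_def
        by (intro exI[of _ m] exI[of _ "\<lambda>i. max (max (t i) a) b"]) (use t ab in auto)
      then have "v3 \<le> arc_length \<gamma> b 1" unfolding arc_length_def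
        using rectifiable_pathD[OF assms] ab by (intro cSup_upper) auto
      moreover have "v2 \<le> (\<Sum>i<m. e')" unfolding v2_def
      proof (intro sum_mono less_imp_le dd)
        fix i assume "i \<in> {..<m}"
        show "min (max (t i) a) b \<in> {0..1}" "min (max (t (Suc i)) a) b \<in> {0..1}"
          using ab by auto
        show "dist (min (max (t i) a) b) (min (max (t (Suc i)) a) b) < d"
          using ab by (auto simp: dist_real_def min_def max_def)
      qed
      moreover have "(\<Sum>i<m. e') < e/2"
        using e unfolding e'_def by (simp add: field_simps)
      moreover have "v \<le> v1 + (v2 + v3)"
        unfolding v v1_def v2_def v3_def sum.distrib[symmetric]
      proof (rule sum_mono)
        fix i assume "i \<in> {..<m}"
        then have le: "t i \<le> t (Suc i)" "max (t i) a \<le> max (t (Suc i)) a" using t(2) by auto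
        show "dist (\<gamma> (t i)) (\<gamma> (t (Suc i))) \<le> dist (\<gamma> (min (t i) a)) (\<gamma> (min (t (Suc i)) a)) +
          (dist (\<gamma> (min (max (t i) a) b)) (\<gamma> (min (max (t (Suc i)) a) b)) +
           dist (\<gamma> (max (max (t i) a) b)) (\<gamma> (max (max (t (Suc i)) a) b)))"
          using dist_split_min_max[OF le(1), of \<gamma> a] dist_split_min_max[OF le(2), of \<gamma> b] by linarith
      qed
      moreover have "arc_length \<gamma> 0 1 = arc_length \<gamma> 0 a + arc_length \<gamma> a b + arc_length \<gamma> b 1"
        using arc_length_add[OF rectifiable_pathD[OF assms], of 0 1 a]
          arc_length_add[OF rectifiable_pathD[OF assms], of a 1 b] ab by auto
      ultimately show ?thesis using \<open>arc_length \<gamma> 0 1 - e/2 < v\<close> by linarith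
    qed
    then show ?thesis using d by blast
  qed
  show ?thesis
    unfolding continuous_on_iff
  proof (intro ballI allI impI)
    fix x e :: real assume x: "x \<in> {0..1}" and "e > 0"
    then obtain d where d: "d > 0"
      and dd: "\<And>a b. 0 \<le> a \<Longrightarrow> a \<le> b \<Longrightarrow> b \<le> 1 \<Longrightarrow> b - a < d \<Longrightarrow> arc_length \<gamma> a b < e"
      using small by meson
    have "dist (arc_length \<gamma> 0 x') (arc_length \<gamma> 0 x) < e" if x': "x' \<in> {0..1}" "dist x' x < d" for x'
    proof (cases "x \<le> x'")
      case True
      then show ?thesis using arc_length_diff[OF assms, of x x'] arc_length_nonneg[OF assms, of x x']
          dd[of x x'] x x' by (auto simp: dist_real_def)
    next
      case False
      then show ?thesis using arc_length_diff[OF assms, of x' x] arc_length_nonneg[OF assms, of x' x]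
          dd[of x' x] x x' by (auto simp: dist_real_def)
    qed
    then show "\<exists>d>0. \<forall>x'\<in>{0..1}. dist x' x < d \<longrightarrow> dist (arc_length \<gamma> 0 x') (arc_length \<gamma> 0 x) < e"
      using d by blast
  qed
qed

text \<open>The choice in \<open>arc_param\<close> is harmless: two parameters with the same length
  from 0 bound a piece of length 0, whose endpoints coincide by
  \<open>dist_le_arc_length\<close>.\<close>

lemma arc_param_arc_length:
  assumes "rectifiable_path \<gamma>" "t \<in> {0..1}"
  shows "arc_param \<gamma> (arc_length \<gamma> 0 t) = \<gamma> t"
proof -
  have eq: "\<gamma> a = \<gamma> b" if "0 \<le> a" "a \<le> b" "b \<le> 1" "arc_length \<gamma> 0 a = arc_length \<gamma> 0 b" for a b
    using dist_le_arc_length[OF rectifiable_pathD[OF assms(1)], of a b]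
      arc_length_diff[OF assms(1), of a b] that by auto
  define u where "u = (SOME u. u \<in> {0..1} \<and> arc_length \<gamma> 0 u = arc_length \<gamma> 0 t)"
  have u: "u \<in> {0..1} \<and> arc_length \<gamma> 0 u = arc_length \<gamma> 0 t"
    unfolding u_def by (rule someI[of _ t]) (use assms in auto)
  have "\<gamma> u = \<gamma> t"
  proof (cases "u \<le> t")
    case True then show ?thesis using eq[of u t] u assms(2) by simp
  next
    case False then show ?thesis using eq[of t u] u assms(2) by simp
  qed
  then show ?thesis unfolding arc_param_def u_def .
qed

lemma arc_length_surj:
  assumes "rectifiable_path \<gamma>" "s \<in> {0..arc_length \<gamma> 0 1}"
  obtains t where "t \<in> {0..1}" "arc_length \<gamma> 0 t = s"
  using IVT'[of "arc_length \<gamma> 0" 0 s 1] arc_length_continuous[OF assms(1)] assms(2) that by auto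

lemma arc_param_in_image:
  assumes "rectifiable_path \<gamma>" "s \<in> {0..arc_length \<gamma> 0 1}"
  shows "arc_param \<gamma> s \<in> path_image \<gamma>"
  using arc_length_surj[OF assms] arc_param_arc_length[OF assms(1)] unfolding path_image_def
  by (metis imageI)

lemma arc_param_dist:
  assumes "rectifiable_path \<gamma>" "s \<in> {0..arc_length \<gamma> 0 1}" "s' \<in> {0..arc_length \<gamma> 0 1}"
  shows "dist (arc_param \<gamma> s) (arc_param \<gamma> s') \<le> \<bar>s - s'\<bar>"
proof -
  obtain t where t: "t \<in> {0..1}" "arc_length \<gamma> 0 t = s" using arc_length_surj[OF assms(1,2)] .
  obtain u where u: "u \<in> {0..1}" "arc_length \<gamma> 0 u = s'" using arc_length_surj[OF assms(1,3)] .
  have *: "dist (\<gamma> a) (\<gamma> b) \<le> arc_length \<gamma> 0 b - arc_length \<gamma> 0 a"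
    if "0 \<le> a" "a \<le> b" "b \<le> 1" for a b
    using dist_le_arc_length[OF rectifiable_pathD[OF assms(1)], of a b]
      arc_length_diff[OF assms(1), of a b] that by auto
  have "dist (\<gamma> t) (\<gamma> u) \<le> \<bar>s - s'\<bar>"
    using *[of t u] *[of u t] t u by (cases "t \<le> u") (auto simp: dist_commute)
  then show ?thesis using arc_param_arc_length[OF assms(1)] t u by metis
qed

lemma arc_param_continuous:
  assumes "rectifiable_path \<gamma>"
  shows "continuous_on {0..arc_length \<gamma> 0 1} (arc_param \<gamma>)"
proof -
  have "1-lipschitz_on {0..arc_length \<gamma> 0 1} (arc_param \<gamma>)"
    using arc_param_dist[OF assms] by (auto simp: lipschitz_on_def dist_real_def)
  then show ?thesis by (rule lipschitz_on_continuous_on)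
qed

section \<open>Line integrals along segments and joined paths\<close>

lemma arc_param_integrable:
  fixes f :: "'a::euclidean_space \<Rightarrow> real"
  assumes "rectifiable_path \<gamma>" "path_image \<gamma> \<subseteq> G" "continuous_on G f" "0 \<le> a" "b \<le> arc_length \<gamma> 0 1"
  shows "(\<lambda>s. f (arc_param \<gamma> s)) integrable_on {a..b}"
proof (intro integrable_continuous_real)
  have "continuous_on {0..arc_length \<gamma> 0 1} (\<lambda>s. f (arc_param \<gamma> s))"
    by (rule continuous_on_compose2[OF assms(3) arc_param_continuous[OF assms(1)]])
      (use arc_param_in_image[OF assms(1)] assms(2) in blast)
  then show "continuous_on {a..b} (\<lambda>s. f (arc_param \<gamma> s))"
    by (rule continuous_on_subset) (use assms in auto)
qed

lemma line_integral_le: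
  fixes f :: "'a::euclidean_space \<Rightarrow> real"
  assumes "rectifiable_path \<gamma>" "path_image \<gamma> \<subseteq> G" "continuous_on G f"
    and "\<And>z. z \<in> path_image \<gamma> \<Longrightarrow> f z \<le> C"
  shows "line_integral f \<gamma> \<le> C * arc_length \<gamma> 0 1"
proof -
  have "line_integral f \<gamma> \<le> integral {0..arc_length \<gamma> 0 1} (\<lambda>s. C)"
    unfolding line_integral_def
    using arc_param_integrable[OF assms(1-3)] arc_param_in_image[OF assms(1)] assms(4)
    by (intro integral_le) auto
  also have "\<dots> = C * arc_length \<gamma> 0 1"
    using arc_length_nonneg[OF assms(1), of 0 1] by simp
  finally show ?thesis .
qed

lemma variation_sums_linepath_le:
  assumes "v \<in> variation_sums (linepath x y) 0 1"
  shows "v \<le> dist x y"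
proof -
  obtain m t where v: "v = (\<Sum>i<m. dist (linepath x y (t i)) (linepath x y (t (Suc i))))"
    and t: "\<forall>i\<le>m. 0 \<le> t i \<and> t i \<le> 1" "\<forall>i<m. t i \<le> t (Suc i)"
    using assms unfolding variation_sums_iff by auto
  have d: "dist (linepath x y a) (linepath x y b) = (b - a) * dist x y" if "a \<le> b" for a b
  proof -
    have "linepath x y a - linepath x y b = (b - a) *\<^sub>R (x - y)"
      by (simp add: linepath_def algebra_simps)
    then show ?thesis using that by (simp add: dist_norm)
  qed
  have "v = (\<Sum>i<m. (t (Suc i) - t i) * dist x y)"
    unfolding v using t(2) by (intro sum.cong) (auto simp: d)
  also have "\<dots> = (t m - t 0) * dist x y"
    unfolding sum_distrib_right[symmetric] by (simp add: sum_lessThan_telescope)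
  also have "\<dots> \<le> 1 * dist x y"
  proof (rule mult_right_mono)
    have "t m \<le> 1" "0 \<le> t 0" using t(1) by auto
    then show "t m - t 0 \<le> 1" by linarith
  qed simp
  finally show ?thesis by simp
qed

lemma rectifiable_linepath: "rectifiable_path (linepath x y)"
  unfolding rectifiable_path_def using variation_sums_linepath_le[of _ x y]
  by (auto intro!: bdd_aboveI[of _ "dist x y"])

lemma arc_length_linepath_le: "arc_length (linepath x y) 0 1 \<le> dist x y"
  unfolding arc_length_def
  by (rule cSup_least) (use variation_sums_nonempty[of 0 1 "linepath x y"] variation_sums_linepath_le in auto)

text \<open>Each half of the joined path is an affine reparametrization of \<gamma>1 or \<gamma>2.
  Hence its arc length parametrization runs through that of \<gamma>1 on \<open>{0..L1}\<close> and
  then, shifted by \<open>L1\<close>, through that of \<gamma>2, and the integral splits at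
  \<open>L1\<close>.\<close>

lemma line_integral_join:
  fixes f :: "'a::euclidean_space \<Rightarrow> real"
  assumes r1: "rectifiable_path \<gamma>1" "path_image \<gamma>1 \<subseteq> G"
    and r2: "rectifiable_path \<gamma>2" "path_image \<gamma>2 \<subseteq> G"
    and j: "pathfinish \<gamma>1 = pathstart \<gamma>2" and f: "continuous_on G f"
  shows "rectifiable_path (\<gamma>1 +++ \<gamma>2)"
    and "line_integral f (\<gamma>1 +++ \<gamma>2) = line_integral f \<gamma>1 + line_integral f \<gamma>2"
proof -
  let ?\<gamma> = "\<gamma>1 +++ \<gamma>2"
  have j1: "?\<gamma> (t/2) = \<gamma>1 t" if "t \<in> {0..1}" for t
    using that by (simp add: joinpaths_def)
  have j2: "?\<gamma> ((t+1)/2) = \<gamma>2 t" if "t \<in> {0..1}" for t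
  \<comment> \<open>At \<open>t = 0\<close> the parameter is 1/2, where \<open>joinpaths\<close>
    still uses \<gamma>1; the junction condition \<open>j\<close> identifies the two values.\<close>
  proof (cases "t = 0")
    case True then show ?thesis using j by (simp add: joinpaths_def pathstart_def pathfinish_def)
  next
    case False then show ?thesis using that by (simp add: joinpaths_def field_simps)
  qed
  have VS1: "variation_sums ?\<gamma> 0 (t/2) = variation_sums \<gamma>1 0 t" if t: "t \<in> {0..1}" for t
  proof
    show "variation_sums ?\<gamma> 0 (t/2) \<subseteq> variation_sums \<gamma>1 0 t"
      by (rule variation_sums_reparam[where h = "\<lambda>x. 2*x"])
        (use t in \<open>auto intro!: mono_onI simp: joinpaths_def\<close>)
    show "variation_sums \<gamma>1 0 t \<subseteq> variation_sums ?\<gamma> 0 (t/2)"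
      by (rule variation_sums_reparam[where h = "\<lambda>x. x/2"])
        (use t j1 in \<open>auto intro!: mono_onI\<close>)
  qed
  have VS2: "variation_sums ?\<gamma> (1/2) ((t+1)/2) = variation_sums \<gamma>2 0 t" if t: "t \<in> {0..1}" for t
  proof
    show "variation_sums ?\<gamma> (1/2) ((t+1)/2) \<subseteq> variation_sums \<gamma>2 0 t"
    proof (rule variation_sums_reparam[where h = "\<lambda>x. 2*x-1"])
      fix x assume "x \<in> {1/2..(t+1)/2}"
      then show "?\<gamma> x = \<gamma>2 (2*x-1)" using j2[of "2*x-1"] t by auto
    qed (auto intro!: mono_onI)
    show "variation_sums \<gamma>2 0 t \<subseteq> variation_sums ?\<gamma> (1/2) ((t+1)/2)"
      by (rule variation_sums_reparam[where h = "\<lambda>x. (x+1)/2"])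
        (use t j2 in \<open>auto intro!: mono_onI\<close>)
  qed
  have b1: "bdd_above (variation_sums ?\<gamma> 0 (1/2))" "bdd_above (variation_sums ?\<gamma> (1/2) 1)"
    using VS1[of 1] VS2[of 1] r1(1) r2(1) unfolding rectifiable_path_def by auto
  have "bdd_above (variation_sums ?\<gamma> 0 1)"
  proof (rule bdd_aboveI)
    fix v assume "v \<in> variation_sums ?\<gamma> 0 1"
    then obtain v1 v2 where "v1 \<in> variation_sums ?\<gamma> 0 (1/2)" "v2 \<in> variation_sums ?\<gamma> (1/2) 1" "v \<le> v1 + v2"
      using variation_sums_le_add[of v ?\<gamma> 0 1 "1/2"] by auto
    then show "v \<le> Sup (variation_sums ?\<gamma> 0 (1/2)) + Sup (variation_sums ?\<gamma> (1/2) 1)"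
      using cSup_upper b1 by (smt (verit, best))
  qed
  then show r: "rectifiable_path ?\<gamma>"
    using r1(1) r2(1) j unfolding rectifiable_path_def by auto
  define L1 where "L1 = arc_length \<gamma>1 0 1"
  define L2 where "L2 = arc_length \<gamma>2 0 1"
  have L: "0 \<le> L1" "0 \<le> L2" unfolding L1_def L2_def using arc_length_nonneg[OF r1(1)] arc_length_nonneg[OF r2(1)] by auto
  have l1: "arc_length ?\<gamma> 0 (t/2) = arc_length \<gamma>1 0 t" if "t \<in> {0..1}" for t
    unfolding arc_length_def VS1[OF that] ..
  have l2: "arc_length ?\<gamma> 0 ((t+1)/2) = L1 + arc_length \<gamma>2 0 t" if t: "t \<in> {0..1}" for t
  proof -
    have "arc_length ?\<gamma> 0 ((t+1)/2) = arc_length ?\<gamma> 0 (1/2) + arc_length ?\<gamma> (1/2) ((t+1)/2)"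
      using arc_length_diff[OF r, of "1/2" "(t+1)/2"] t by auto
    also have "arc_length ?\<gamma> (1/2) ((t+1)/2) = arc_length \<gamma>2 0 t"
      unfolding arc_length_def VS2[OF that] ..
    finally show ?thesis using l1[of 1] unfolding L1_def by simp
  qed
  have tot: "arc_length ?\<gamma> 0 1 = L1 + L2" using l2[of 1] unfolding L2_def by simp
  have p1: "arc_param ?\<gamma> s = arc_param \<gamma>1 s" if s: "s \<in> {0..L1}" for s
  proof -
    obtain t where t: "t \<in> {0..1}" "arc_length \<gamma>1 0 t = s"
      using arc_length_surj[OF r1(1)] s unfolding L1_def by blast
    then have "arc_param ?\<gamma> s = ?\<gamma> (t/2)"
      using arc_param_arc_length[OF r, of "t/2"] l1[of t] by auto
    then show ?thesis using j1 t arc_param_arc_length[OF r1(1)] by metis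
  qed
  have p2: "arc_param ?\<gamma> (s + L1) = arc_param \<gamma>2 s" if s: "s \<in> {0..L2}" for s
  proof -
    obtain t where t: "t \<in> {0..1}" "arc_length \<gamma>2 0 t = s"
      using arc_length_surj[OF r2(1)] s unfolding L2_def by blast
    then have "arc_param ?\<gamma> (s + L1) = ?\<gamma> ((t+1)/2)"
      using arc_param_arc_length[OF r, of "(t+1)/2"] l2[of t] by (auto simp: add.commute)
    then show ?thesis using j2 t arc_param_arc_length[OF r2(1)] by metis
  qed
  have im: "path_image ?\<gamma> \<subseteq> G" using r1 r2 by (simp add: path_image_join j)
  let ?F = "\<lambda>s. f (arc_param ?\<gamma> s)"
  have "line_integral f ?\<gamma> = integral {0..L1+L2} ?F" unfolding line_integral_def tot ..
  also have "\<dots> = integral {0..L1} ?F + integral {L1..L1+L2} ?F"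
    using Henstock_Kurzweil_Integration.integral_combine[of 0 L1 "L1+L2" ?F] L arc_param_integrable[OF r im f, of 0 "L1+L2"] tot by simp
  also have "integral {0..L1} ?F = line_integral f \<gamma>1"
    unfolding line_integral_def L1_def[symmetric] by (intro integral_cong) (simp add: p1)
  also have "integral {L1..L1+L2} ?F = integral {0..L2} (\<lambda>s. ?F (s + L1))"
    using integral_shift_real_ivl[of L1 L1 "L1+L2" ?F] by simp
  also have "\<dots> = line_integral f \<gamma>2"
    unfolding line_integral_def L2_def[symmetric] by (intro integral_cong) (simp add: p2)
  finally show "line_integral f ?\<gamma> = line_integral f \<gamma>1 + line_integral f \<gamma>2" .
qed

section \<open>Quasihyperbolic length and chains\<close>

text \<open>On an open \<open>G \<noteq> UNIV\<close> this agrees with \<^const>\<open>bdist\<close>, and it is easier to bound from below.\<close>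

definition codist :: "'a::metric_space set \<Rightarrow> 'a \<Rightarrow> real" where
  "codist G z = infdist z (- G)"

lemma codist_le: "w \<notin> G \<Longrightarrow> codist G z \<le> dist z w"
  unfolding codist_def by (simp add: infdist_le)

lemma codist_nonneg [simp]: "0 \<le> codist G z"
  unfolding codist_def by (rule infdist_nonneg)

lemma codist_triangle: "codist G z \<le> codist G w + dist z w"
  unfolding codist_def by (rule infdist_triangle)

text \<open>\<open>infdist\<close> to the empty set is 0 by convention, so a lower bound by \<rho>
  requires a nonempty complement.\<close>

lemma codist_ge:
  assumes "G \<noteq> UNIV" "\<And>w. w \<notin> G \<Longrightarrow> \<rho> \<le> dist z w"
  shows "\<rho> \<le> codist G z"
  unfolding codist_def using assms by (auto simp: infdist_def intro!: cINF_greatest)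

lemma codist_pos:
  assumes "open G" "G \<noteq> UNIV" "z \<in> G" shows "0 < codist G z"
proof -
  have "closed (- G)" "- G \<noteq> {}" "z \<notin> - G" using assms by auto
  then have "infdist z (- G) \<noteq> 0" using in_closed_iff_infdist_zero by blast
  then show ?thesis unfolding codist_def using infdist_nonneg[of z "- G"] by simp
qed

lemma codist_subset: "G \<subseteq> H \<Longrightarrow> H \<noteq> UNIV \<Longrightarrow> codist G z \<le> codist H z"
  by (rule codist_ge) (auto intro: codist_le)

text \<open>A segment from \<open>z\<close> to a point outside \<open>G\<close> meets the frontier
  no farther away than that point; conversely the frontier of an open set lies in its
  complement.\<close>

lemma bdist_eq_codist:
  assumes "open G" "z \<in> G" "G \<noteq> UNIV"
  shows "bdist G z = codist G z"
proof (rule antisym)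
  have fne: "frontier G \<noteq> {}" using assms frontier_not_empty by blast
  show "bdist G z \<le> codist G z"
  proof (rule codist_ge[OF assms(3)])
    fix w assume "w \<notin> G"
    then obtain p where p: "p \<in> closed_segment z w" "p \<in> frontier G"
      using connected_Int_frontier[of "closed_segment z w" G] assms(2) by auto
    then have "dist z p \<le> dist z w"
      using dist_in_closed_segment[OF p(1)] by (simp add: dist_commute)
    then show "bdist G z \<le> dist z w"
      unfolding bdist_def using infdist_le[OF p(2), of z] by linarith
  qed
  show "codist G z \<le> bdist G z"
    unfolding bdist_def codist_def
    by (rule infdist_mono) (use assms fne in \<open>auto simp: frontier_def interior_open\<close>)
qed

section \<open>Chains and quasihyperbolic length\<close>

definition chain_step :: "real \<Rightarrow> 'a::metric_space set \<Rightarrow> ('a \<times> 'a) set" where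
  "chain_step l G = {(u, v). u \<in> G \<and> v \<in> G \<and> dist u v \<le> l * codist G u \<and> dist u v \<le> l * codist G v}"

text \<open>The argument \<open>t\<close> is any upper bound for the ratio |x - y| / min, not the
  ratio itself: this avoids division and lets each application choose a convenient bound.\<close>

definition chain_uniform :: "(real \<Rightarrow> nat) \<Rightarrow> 'a::metric_space set \<Rightarrow> bool" where
  "chain_uniform f G \<longleftrightarrow> (\<forall>x\<in>G. \<forall>y\<in>G. \<forall>t. dist x y \<le> t * codist G x \<longrightarrow> dist x y \<le> t * codist G y \<longrightarrow>
      (x, y) \<in> chain_step (1/2) G ^^ f t)"

lemma chain_step_sym: "(u, v) \<in> chain_step l G \<Longrightarrow> (v, u) \<in> chain_step l G"
  unfolding chain_step_def by (auto simp: dist_commute)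

lemma chain_step_refl: "u \<in> G \<Longrightarrow> 0 \<le> l \<Longrightarrow> (u, u) \<in> chain_step l G"
  unfolding chain_step_def by auto

lemma relpow_trans: "(x, y) \<in> R ^^ m \<Longrightarrow> (y, z) \<in> R ^^ n \<Longrightarrow> (x, z) \<in> R ^^ (m + n)"
  by (auto simp: relpow_add)

lemma chain_sym: "(u, v) \<in> chain_step l G ^^ n \<Longrightarrow> (v, u) \<in> chain_step l G ^^ n"
proof (induction n arbitrary: v)
  case (Suc n)
  then show ?case by (meson chain_step_sym relpow_Suc_E relpow_Suc_I2)
qed simp

text \<open>Constant steps are allowed, so a chain of exactly \<open>n\<close> steps is as good as
  one of at most \<open>n\<close>.\<close>

lemma chain_pad:
  assumes "(u, v) \<in> chain_step l G ^^ m" "v \<in> G" "0 \<le> l" "m \<le> n"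
  shows "(u, v) \<in> chain_step l G ^^ n"
proof -
  have "(v, v) \<in> chain_step l G ^^ k" for k
    by (induction k) (use assms chain_step_refl in \<open>auto intro: relpow_Suc_I\<close>)
  then show ?thesis using relpow_trans[OF assms(1), of v "n - m"] assms(4) by auto
qed

text \<open>An upper bound for the quasihyperbolic distance witnessed by one path, so that
  concatenation involves no infimum.\<close>

definition qh_reach :: "'a::euclidean_space set \<Rightarrow> 'a \<Rightarrow> 'a \<Rightarrow> real \<Rightarrow> bool" where
  "qh_reach G x y M \<longleftrightarrow> (\<exists>\<gamma>. rectifiable_path \<gamma> \<and> path_image \<gamma> \<subseteq> G \<and> pathstart \<gamma> = x \<and> pathfinish \<gamma> = y \<and>
      line_integral (\<lambda>z. 1 / bdist G z) \<gamma> \<le> M)"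

lemma bdist_pos:
  assumes "open G" "G \<noteq> UNIV" "z \<in> G" shows "0 < bdist G z"
  using assms bdist_eq_codist codist_pos by metis

lemma continuous_inverse_bdist:
  assumes "open G" "G \<noteq> UNIV"
  shows "continuous_on G (\<lambda>z. 1 / bdist G z)"
  unfolding bdist_def
  using bdist_pos[OF assms] by (intro continuous_intros) (fastforce simp: bdist_def)

lemma qh_reach_trans:
  assumes G: "open G" "G \<noteq> UNIV" and "qh_reach G x y M" "qh_reach G y z N"
  shows "qh_reach G x z (M + N)"
proof -
  obtain a where a: "rectifiable_path a" "path_image a \<subseteq> G" "pathstart a = x" "pathfinish a = y"
    "line_integral (\<lambda>z. 1 / bdist G z) a \<le> M" using assms unfolding qh_reach_def by auto
  obtain b where b: "rectifiable_path b" "path_image b \<subseteq> G" "pathstart b = y" "pathfinish b = z"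
    "line_integral (\<lambda>z. 1 / bdist G z) b \<le> N" using assms unfolding qh_reach_def by auto
  note J = line_integral_join[OF a(1,2) b(1,2) _ continuous_inverse_bdist[OF G]]
  show ?thesis unfolding qh_reach_def
    using J a b by (intro exI[of _ "a +++ b"]) (auto simp: path_image_join)
qed

text \<open>Along the segment the distance to the complement stays at least half its value at
  \<open>x\<close>, so the density is at most \<open>2 / codist G x\<close>. A chain step therefore
  costs at most 1; the explicit bound is kept for nearby points.\<close>

lemma qh_reach_segment:
  assumes G: "open G" "G \<noteq> UNIV" and x: "x \<in> G" and d: "dist x y \<le> 1/2 * codist G x"
  shows "qh_reach G x y (2 * dist x y / codist G x)"
proof -
  let ?\<gamma> = "linepath x y"
  have p: "0 < codist G x" by (rule codist_pos[OF G x])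
  have z: "z \<in> G \<and> codist G x / 2 \<le> codist G z" if "z \<in> closed_segment x y" for z
  proof -
    have "dist x z \<le> codist G x / 2"
      using dist_in_closed_segment[OF that] d by (simp add: dist_commute)
    then show ?thesis using p codist_le[of z G x] codist_triangle[of G x z] by force
  qed
  have im: "path_image ?\<gamma> \<subseteq> G" using z by auto
  have "1 / bdist G z \<le> 2 / codist G x" if "z \<in> path_image ?\<gamma>" for z
    using z[of z] that p bdist_eq_codist[OF G(1) _ G(2), of z] by (auto simp: field_simps)
  then have "line_integral (\<lambda>z. 1 / bdist G z) ?\<gamma> \<le> 2 / codist G x * arc_length ?\<gamma> 0 1"
    by (intro line_integral_le[OF rectifiable_linepath im continuous_inverse_bdist[OF G]])
  also have "\<dots> \<le> 2 / codist G x * dist x y"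
    using arc_length_linepath_le p by (intro mult_left_mono) auto
  finally show ?thesis unfolding qh_reach_def
    using im by (intro exI[of _ ?\<gamma>]) (auto simp: rectifiable_linepath)
qed

lemma chain_imp_qh_reach:
  assumes G: "open G" "G \<noteq> UNIV" and x: "x \<in> G" and ch: "(x, y) \<in> chain_step (1/2) G ^^ n"
  shows "qh_reach G x y (real n)"
  using ch
proof (induction n arbitrary: y)
  case 0
  then show ?case using qh_reach_segment[OF G x, of x] by simp
next
  case (Suc n)
  then obtain z where z: "(x, z) \<in> chain_step (1/2) G ^^ n" "(z, y) \<in> chain_step (1/2) G"
    by auto
  have zG: "z \<in> G" and d: "dist z y \<le> 1/2 * codist G z"
    using z(2) unfolding chain_step_def by auto
  have "2 * dist z y / codist G z \<le> 1"
    using d codist_pos[OF G zG] by (simp add: field_simps)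
  then have "qh_reach G z y 1"
    using qh_reach_segment[OF G zG d] unfolding qh_reach_def by (metis order_trans)
  then show ?case using qh_reach_trans[OF G Suc.IH[OF z(1)]] by (simp add: add.commute)
qed

lemma qh_metric_le:
  assumes G: "open G" "G \<noteq> UNIV" and "qh_reach G x y M"
  shows "qh_metric G x y \<le> M"
proof -
  let ?S = "{line_integral (\<lambda>z. 1 / bdist G z) \<gamma> | \<gamma>.
            rectifiable_path \<gamma> \<and> path_image \<gamma> \<subseteq> G \<and> pathstart \<gamma> = x \<and> pathfinish \<gamma> = y}"
  obtain \<gamma> where g: "rectifiable_path \<gamma>" "path_image \<gamma> \<subseteq> G" "pathstart \<gamma> = x" "pathfinish \<gamma> = y"
    "line_integral (\<lambda>z. 1 / bdist G z) \<gamma> \<le> M" using assms unfolding qh_reach_def by auto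
  have "bdd_below ?S"
  proof (rule bdd_belowI[of _ 0])
    fix v assume "v \<in> ?S"
    then obtain \<gamma> where v: "v = line_integral (\<lambda>z. 1 / bdist G z) \<gamma>" by auto
    \<comment> \<open>Only the value is retained, not the integrability; a non-integrable function
      has integral 0 by convention, so 0 is a lower bound in either case.\<close>
    show "0 \<le> v" unfolding v line_integral_def bdist_def
      using infdist_nonneg by (cases "(\<lambda>s. 1 / infdist (arc_param \<gamma> s) (frontier G)) integrable_on {0..arc_length \<gamma> 0 1}") (auto intro!: Henstock_Kurzweil_Integration.integral_nonneg simp: not_integrable_integral)
  qed
  then have "Inf ?S \<le> line_integral (\<lambda>z. 1 / bdist G z) \<gamma>"
    using g by (intro cInf_lower) auto
  then show ?thesis unfolding qh_metric_def using g(5) by linarith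
qed

text \<open>Greedy walk along the arc length parametrization: from \<open>g s\<close> advance by a
  third of the distance to the complement. A budget of \<open>n\<close> quarters pays for at most
  \<open>n\<close> full advances, and one last step reaches \<open>y\<close>, whence
  \<open>Suc n\<close>.\<close>

lemma qh_reach_imp_chain:
  assumes G: "open G" "G \<noteq> UNIV" and "qh_reach G x y M" and M: "M \<le> real n / 4"
  shows "(x, y) \<in> chain_step (1/2) G ^^ Suc n"
proof -
  obtain \<gamma> where r: "rectifiable_path \<gamma>" "path_image \<gamma> \<subseteq> G" "pathstart \<gamma> = x" "pathfinish \<gamma> = y"
    "line_integral (\<lambda>z. 1 / bdist G z) \<gamma> \<le> M" using assms unfolding qh_reach_def by auto
  define g where "g = arc_param \<gamma>"
  define L where "L = arc_length \<gamma> 0 1"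
  define F where "F s = 1 / bdist G (g s)" for s
  have L: "0 \<le> L" unfolding L_def using arc_length_nonneg[OF r(1)] by simp
  have gG: "g s \<in> G" if "0 \<le> s" "s \<le> L" for s
    using arc_param_in_image[OF r(1), of s] that r(2) unfolding g_def L_def by auto
  have gd: "dist (g s) (g s') \<le> \<bar>s - s'\<bar>" if "0 \<le> s" "s \<le> L" "0 \<le> s'" "s' \<le> L" for s s'
    using arc_param_dist[OF r(1), of s s'] that unfolding g_def L_def by auto
  have int: "F integrable_on {a..b}" if "0 \<le> a" "b \<le> L" for a b
    using arc_param_integrable[OF r(1,2) continuous_inverse_bdist[OF G], of a b] that
    unfolding F_def g_def L_def by auto
  have F0: "0 \<le> F s" for s unfolding F_def bdist_def by (simp add: infdist_nonneg)
  have ends: "g 0 = x" "g L = y"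
    using arc_param_arc_length[OF r(1), of 0] arc_param_arc_length[OF r(1), of 1] r(3,4)
    unfolding g_def L_def pathstart_def pathfinish_def by auto
  \<comment> \<open>Moving by a third of \<open>codist G (g s)\<close> leaves at least two thirds of
    it at the new point, so the step is within one half at both ends.\<close>
  have step: "(g s, g s') \<in> chain_step (1/2) G"
    if "0 \<le> s" "s \<le> s'" "s' \<le> L" "s' - s \<le> codist G (g s) / 3" for s s'
  proof -
    have "dist (g s) (g s') \<le> codist G (g s) / 3" using gd[of s s'] that by auto
    moreover have "g s \<in> G" "g s' \<in> G" using gG that by auto
    moreover have "dist (g s) (g s') \<le> codist G (g s) / 2" "dist (g s) (g s') \<le> codist G (g s') / 2"
      using calculation codist_triangle[of G "g s" "g s'"] zero_le_dist[of "g s" "g s'"] by linarith+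
    ultimately show ?thesis unfolding chain_step_def by auto
  qed
  \<comment> \<open>Advancing by a third of the boundary distance consumes quasihyperbolic length at least 1/4.\<close>
  have quarter: "integral {s + codist G (g s) / 3..L} F \<le> integral {s..L} F - 1/4"
    if s: "0 \<le> s" "s + codist G (g s) / 3 < L" for s
  proof -
    define \<delta> where "\<delta> = codist G (g s)"
    have p: "0 < \<delta>" unfolding \<delta>_def using codist_pos[OF G] gG[of s] s codist_nonneg[of G "g s"] by auto
    have "1 / 4 = integral {s..s + \<delta>/3} (\<lambda>_. 3 / (4 * \<delta>))" using p by simp
    also have "\<dots> \<le> integral {s..s + \<delta>/3} F"
    proof (rule integral_le)
      show "F integrable_on {s..s + \<delta>/3}" using int s unfolding \<delta>_def by auto
      fix u assume u: "u \<in> {s..s + \<delta>/3}"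
      then have uL: "0 \<le> u" "u \<le> L" using s unfolding \<delta>_def by auto
      have "dist (g u) (g s) \<le> \<delta> / 3" using gd[of u s] u uL s p unfolding \<delta>_def by auto
      then have "bdist G (g u) \<le> 4 * \<delta> / 3"
        using codist_triangle[of G "g u" "g s"] bdist_eq_codist[OF G(1) gG[OF uL] G(2)]
        unfolding \<delta>_def by simp
      moreover have "0 < bdist G (g u)" using bdist_pos[OF G gG[OF uL]] .
      ultimately show "3 / (4 * \<delta>) \<le> F u" unfolding F_def using p by (simp add: field_simps)
    qed (rule integrable_const_ivl)
    finally have "1/4 \<le> integral {s..s + \<delta>/3} F" .
    moreover have "integral {s..s + \<delta>/3} F + integral {s + \<delta>/3..L} F = integral {s..L} F"
      by (rule Henstock_Kurzweil_Integration.integral_combine) (use s p int in \<open>auto simp: \<delta>_def\<close>)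
    ultimately show ?thesis unfolding \<delta>_def by simp
  qed
  have Fint: "0 \<le> integral {s..L} F" if "0 \<le> s" for s
    using int[OF that] F0 by (intro Henstock_Kurzweil_Integration.integral_nonneg) auto
  have "(g s, g L) \<in> chain_step (1/2) G ^^ Suc n"
    if "0 \<le> s" "s \<le> L" "integral {s..L} F \<le> real n / 4" for s n
    using that
  proof (induction n arbitrary: s)
    \<comment> \<open>A full advance would make the remaining integral negative, so a single step
      reaches the end.\<close>
    case (0 s)
    have "\<not> s + codist G (g s) / 3 < L"
      using quarter[OF 0(1)] Fint[of "s + codist G (g s) / 3"] 0 codist_nonneg[of G "g s"] by auto
    then show ?case using step[of s L] 0 by auto
  next
    case (Suc n s)
    show ?case
    proof (cases "s + codist G (g s) / 3 < L")
      case True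
      have "(g (s + codist G (g s) / 3), g L) \<in> chain_step (1/2) G ^^ Suc n"
        using quarter[OF Suc.prems(1) True] Suc.prems True codist_nonneg[of G "g s"]
        by (intro Suc.IH) (auto simp: add_divide_distrib)
      moreover have "(g s, g (s + codist G (g s) / 3)) \<in> chain_step (1/2) G"
        using Suc.prems True by (intro step) auto
      ultimately show ?thesis by (rule relpow_Suc_I2[rotated])
    next
      case False
      then have "(g s, g L) \<in> chain_step (1/2) G ^^ 1" using step[of s L] Suc.prems by auto
      then show ?thesis by (rule chain_pad) (use gG[of L] L in auto)
    qed
  qed
  from this[of 0 n] show ?thesis
    using L ends r(5) M unfolding line_integral_def F_def g_def L_def by auto
qed

text \<open>Being joined by some chain is an equivalence relation with open classes. This provides
  the path which shows that the infimum in \<open>qh_metric\<close> is over a nonempty set.\<close>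

lemma chain_exists:
  assumes "open G" "connected G" "G \<noteq> UNIV" "x \<in> G" "y \<in> G"
  shows "\<exists>n. (x, y) \<in> chain_step (1/2) G ^^ n"
proof (rule connected_equivalence_relation[OF assms(2,4,5)])
  fix u v w assume "\<exists>n. (u, v) \<in> chain_step (1/2) G ^^ n" "\<exists>n. (v, w) \<in> chain_step (1/2) G ^^ n"
  then show "\<exists>n. (u, w) \<in> chain_step (1/2) G ^^ n" by (meson relpow_trans)
next
  fix a assume a: "a \<in> G"
  let ?d = "codist G a"
  have p: "0 < ?d" by (rule codist_pos[OF assms(1,3) a])
  show "\<exists>T. openin (top_of_set G) T \<and> a \<in> T \<and> (\<forall>z\<in>T. \<exists>n. (a, z) \<in> chain_step (1/2) G ^^ n)"
  proof (intro exI[of _ "G \<inter> ball a (?d/3)"] conjI ballI)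
    show "openin (top_of_set G) (G \<inter> ball a (?d/3))" by (simp add: openin_open_Int)
    show "a \<in> G \<inter> ball a (?d/3)" using a p by simp
    fix z assume z: "z \<in> G \<inter> ball a (?d/3)"
    then have "(a, z) \<in> chain_step (1/2) G"
      using codist_triangle[of G a z] a p unfolding chain_step_def by auto
    then show "\<exists>n. (a, z) \<in> chain_step (1/2) G ^^ n" by (intro exI[of _ 1]) simp
  qed
qed (use chain_sym in blast)

section \<open>Uniformity expressed by chains\<close>

lemma uniform_imp_chain_uniform:
  assumes "halfline_homeo \<phi>"
  shows "\<exists>f. \<forall>G::'a::euclidean_space set. uniform_domain \<phi> G \<longrightarrow> chain_uniform f G"
proof -
  have cont: "continuous_on {0..} \<phi>"
    using assms unfolding halfline_homeo_def homeomorphism_def by auto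
  \<comment> \<open>\<open>N t\<close> comes from a bound for \<phi> on the compact interval
    \<open>{0..t}\<close>, so it depends on \<phi> and \<open>t\<close> alone. The summand 1 makes a
    later inequality strict, so that some path really has quasihyperbolic length below
    \<open>N t / 4\<close>.\<close>
  have "\<exists>n::nat. \<forall>s\<in>{0..t}. \<phi> s + 1 \<le> real n / 4" for t
  proof -
    have "continuous_on {0..t} \<phi>" by (rule continuous_on_subset[OF cont]) auto
    then have "bdd_above (\<phi> ` {0..t})"
      by (intro bounded_imp_bdd_above compact_imp_bounded compact_continuous_image) auto
    then obtain B where B: "\<And>s. s \<in> {0..t} \<Longrightarrow> \<phi> s \<le> B" unfolding bdd_above_def by blast
    obtain n :: nat where "4 * (B + 1) \<le> real n" using real_arch_simple by blast
    then show ?thesis using B by (intro exI[of _ n]) force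
  qed
  then obtain N :: "real \<Rightarrow> nat" where N: "\<And>t s. s \<in> {0..t} \<Longrightarrow> \<phi> s + 1 \<le> real (N t) / 4" by metis
  show ?thesis
  proof (intro exI[of _ "\<lambda>t. Suc (N t)"] allI impI)
    fix G :: "'a set" assume U: "uniform_domain \<phi> G"
    then have G: "open G" "connected G" "G \<noteq> UNIV" unfolding uniform_domain_def domain_def by auto
    show "chain_uniform (\<lambda>t. Suc (N t)) G" unfolding chain_uniform_def
    proof (intro ballI allI impI)
      fix x y t assume x: "x \<in> G" and y: "y \<in> G"
        and d: "dist x y \<le> t * codist G x" "dist x y \<le> t * codist G y"
      let ?m = "min (bdist G x) (bdist G y)"
      have m: "0 < ?m" using bdist_pos[OF G(1,3)] x y by simp
      have "dist x y \<le> t * ?m" using d bdist_eq_codist[OF G(1) _ G(3)] x y by (simp add: min_def)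
      then have "dist x y / ?m \<in> {0..t}" using m by (auto simp: pos_divide_le_eq)
      then have k: "qh_metric G x y < real (N t) / 4"
        using N U x y unfolding uniform_domain_def by (smt (verit, best))
      obtain n where "(x, y) \<in> chain_step (1/2) G ^^ n" using chain_exists[OF G x y] by blast
      then have "qh_reach G x y (real n)" by (rule chain_imp_qh_reach[OF G(1,3) x])
      then have "qh_reach G x y (real (N t) / 4)"
        using cInf_lessD[OF _ k[unfolded qh_metric_def]] unfolding qh_reach_def by force
      then show "(x, y) \<in> chain_step (1/2) G ^^ Suc (N t)"
        by (rule qh_reach_imp_chain[OF G(1,3)]) simp
    qed
  qed
qed

text \<open>A homeomorphism of the half-line vanishes at 0, so \<phi> can dominate \<open>f\<close>
  only away from 0; near 0 the linear term matches the cost of a segment. The partial sums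
  \<open>g\<close> increase even where \<open>f\<close> does not, and integrating them gives
  continuity. For \<open>t \<ge> 1/2\<close> the interval \<open>{2*t..4*t}\<close> has length at
  least 1, so the integral over it is at least \<open>g (2*t)\<close>.\<close>

lemma halfline_homeo_majorant:
  fixes f :: "real \<Rightarrow> nat"
  shows "\<exists>\<phi>. halfline_homeo \<phi> \<and> (\<forall>t\<ge>0. 2 * t \<le> \<phi> t) \<and> (\<forall>t\<ge>1/2. real (f (real (nat \<lceil>t\<rceil>))) \<le> \<phi> t)"
proof -
  define g where "g s = real (\<Sum>n\<le>nat \<lceil>s\<rceil>. f (real n))" for s :: real
  define \<phi> where "\<phi> t = 2 * t + integral {0..4*t} g" for t
  have g0: "0 \<le> g s" for s unfolding g_def by (rule of_nat_0_le_iff)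
  have gm: "g s \<le> g s'" if "s \<le> s'" for s s'
  proof -
    have "nat \<lceil>s\<rceil> \<le> nat \<lceil>s'\<rceil>" using that by (intro nat_mono ceiling_mono)
    then show ?thesis unfolding g_def by (intro of_nat_mono sum_mono2) auto
  qed
  have gi: "g integrable_on {a..b}" for a b
    by (rule integrable_on_mono_on) (auto intro: mono_onI gm)
  have split: "integral {0..b} g = integral {0..a} g + integral {a..b} g" if "0 \<le> a" "a \<le> b" for a b
    using Henstock_Kurzweil_Integration.integral_combine[OF that gi] by simp
  have inn: "0 \<le> integral {a..b} g" for a b
    using gi g0 by (intro Henstock_Kurzweil_Integration.integral_nonneg) auto
  have lt: "\<phi> a < \<phi> b" if "0 \<le> a" "a < b" for a b
    using split[of "4*a" "4*b"] inn[of "4*a" "4*b"] that unfolding \<phi>_def by auto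
  have ge: "2 * t \<le> \<phi> t" for t using inn unfolding \<phi>_def by simp
  have c0: "continuous_on {0..b} \<phi>" for b
  proof -
    have "continuous_on {0..b} (\<lambda>t. integral {0..4*t} g)"
      by (rule continuous_on_compose2[OF indefinite_integral_continuous_1[OF gi, of 0 "4*b"]])
        (auto intro!: continuous_intros)
    then show ?thesis unfolding \<phi>_def by (intro continuous_intros)
  qed
  have cont: "continuous_on {0..} \<phi>"
    unfolding continuous_on_eq_continuous_within
  proof
    fix x :: real assume "x \<in> {0..}"
    then have "continuous (at x within {0..x+1}) \<phi>"
      using c0[of "x+1"] unfolding continuous_on_eq_continuous_within by auto
    moreover have "at x within {0..x+1} = at x within {0..}"
      by (rule at_within_nhd[of x "{..<x+1}"]) auto
    ultimately show "continuous (at x within {0..}) \<phi>" by (simp add: continuous_within)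
  qed
  have "\<phi> ` {0..} = {0..}"
  proof (intro equalityI subsetI)
    fix y :: real assume y: "y \<in> {0..}"
    have "\<exists>x\<ge>0. x \<le> y \<and> \<phi> x = y"
      using IVT'[of \<phi> 0 y y] c0 ge[of y] y by (auto simp: \<phi>_def)
    then show "y \<in> \<phi> ` {0..}" by force
  next
    fix y assume "y \<in> \<phi> ` {0..}"
    then obtain t where "0 \<le> t" "y = \<phi> t" by auto
    then show "y \<in> {0..}" using ge[of t] by auto
  qed
  moreover have "inj_on \<phi> {0..}"
    by (rule linorder_inj_onI) (use lt in fastforce)+
  ultimately have "halfline_homeo \<phi>" unfolding halfline_homeo_def
    using cont by (intro homeomorphism_into_1d) (auto simp: convex_imp_path_connected)
  moreover have "real (f (real (nat \<lceil>t\<rceil>))) \<le> \<phi> t" if t: "1/2 \<le> t" for t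
  proof -
    have "f (real (nat \<lceil>t\<rceil>)) \<le> (\<Sum>n\<le>nat \<lceil>t\<rceil>. f (real n))"
      by (rule member_le_sum) auto
    then have "real (f (real (nat \<lceil>t\<rceil>))) \<le> g t" unfolding g_def by (rule of_nat_mono)
    also have "g t \<le> g (2*t)" using t by (intro gm) auto
    also have "\<dots> \<le> 2*t * g (2*t)" using mult_right_mono[of 1 "2*t" "g (2*t)"] g0 t by simp
    also have "\<dots> = integral {2*t..4*t} (\<lambda>_. g (2*t))" using t by simp
    also have "\<dots> \<le> integral {2*t..4*t} g" using gi gm by (intro integral_le) auto
    also have "\<dots> \<le> \<phi> t" unfolding \<phi>_def
      using split[of "2*t" "4*t"] inn[of 0 "2*t"] t by simp
    finally show ?thesis .
  qed
  ultimately show ?thesis using ge by blast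
qed

lemma chain_uniform_imp_uniform:
  fixes f :: "real \<Rightarrow> nat"
  shows "\<exists>\<phi>. halfline_homeo \<phi> \<and> (\<forall>G::'a::euclidean_space set.
    open G \<longrightarrow> G \<noteq> {} \<longrightarrow> G \<noteq> UNIV \<longrightarrow> chain_uniform f G \<longrightarrow> uniform_domain \<phi> G)"
proof -
  obtain \<phi> where \<phi>: "halfline_homeo \<phi>" "\<And>t. t \<ge> 0 \<Longrightarrow> 2 * t \<le> \<phi> t"
    "\<And>t. t \<ge> 1/2 \<Longrightarrow> real (f (real (nat \<lceil>t\<rceil>))) \<le> \<phi> t"
    using halfline_homeo_majorant by metis
  show ?thesis
  proof (intro exI[of _ \<phi>] conjI allI impI)
    fix G :: "'a set"
    assume G: "open G" "G \<noteq> {}" "G \<noteq> UNIV" and ch: "chain_uniform f G"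
    have reach: "qh_reach G x y (real (f t))"
      if "x \<in> G" "y \<in> G" "dist x y \<le> t * min (bdist G x) (bdist G y)" "0 \<le> t" for x y t
    proof -
      have "t * min (bdist G x) (bdist G y) \<le> t * codist G x"
        "t * min (bdist G x) (bdist G y) \<le> t * codist G y"
        using that bdist_eq_codist[OF G(1) _ G(3)] by (auto intro!: mult_left_mono)
      then have "(x, y) \<in> chain_step (1/2) G ^^ f t"
        using ch that unfolding chain_uniform_def by (meson order_trans)
      then show ?thesis by (rule chain_imp_qh_reach[OF G(1,3) that(1)])
    qed
    have m: "0 < min (bdist G x) (bdist G y)" if "x \<in> G" "y \<in> G" for x y
      using that bdist_pos[OF G(1,3)] by simp
    \<comment> \<open>Connectedness, a part of uniformity, comes from the chains: with
      \<open>t\<close> the ratio itself, any two points are joined by a path.\<close>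
    have "path_connected G" unfolding path_connected_def
    proof (intro ballI)
      fix x y assume xy: "x \<in> G" "y \<in> G"
      have "qh_reach G x y (f (dist x y / min (bdist G x) (bdist G y)))"
        using m[OF xy] by (intro reach[OF xy]) auto
      then show "\<exists>g. path g \<and> path_image g \<subseteq> G \<and> pathstart g = x \<and> pathfinish g = y"
        unfolding qh_reach_def rectifiable_path_def by blast
    qed
    then have conn: "connected G" by (rule path_connected_imp_connected)
    have "qh_metric G x y \<le> \<phi> (dist x y / min (bdist G x) (bdist G y))" if xy: "x \<in> G" "y \<in> G" for x y
    proof -
      define t where "t = dist x y / min (bdist G x) (bdist G y)"
      have d: "dist x y = t * min (bdist G x) (bdist G y)" and t0: "0 \<le> t"
        unfolding t_def using m[OF xy] by auto
      have "qh_metric G x y \<le> \<phi> t"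
      \<comment> \<open>From 1/2 on, the chain count is used, with the ratio rounded up to an
        integer. Below, \<open>y\<close> is within half the distance of \<open>x\<close> to the
        complement and the segment costs at most \<open>2 * t\<close>.\<close>
      proof (cases "1/2 \<le> t")
        case True
        have "t \<le> real (nat \<lceil>t\<rceil>)" by linarith
        then have "dist x y \<le> real (nat \<lceil>t\<rceil>) * min (bdist G x) (bdist G y)"
          unfolding d using m[OF xy] by (intro mult_right_mono) auto
        then have "qh_metric G x y \<le> real (f (real (nat \<lceil>t\<rceil>)))"
          by (intro qh_metric_le[OF G(1,3)] reach xy) auto
        then show ?thesis using \<phi>(3)[OF True] by linarith
      next
        case False
        have p: "0 < codist G x" by (rule codist_pos[OF G(1,3) xy(1)])
        have "dist x y \<le> t * codist G x"
          unfolding d using t0 bdist_eq_codist[OF G(1) xy(1) G(3)] by (intro mult_left_mono) auto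
        moreover have "t * codist G x \<le> 1/2 * codist G x" using False p by (intro mult_right_mono) auto
        ultimately have "qh_metric G x y \<le> 2 * dist x y / codist G x"
          by (intro qh_metric_le[OF G(1,3)] qh_reach_segment[OF G(1,3) xy(1)]) auto
        also have "\<dots> \<le> 2 * t" using \<open>dist x y \<le> t * codist G x\<close> p by (simp add: pos_divide_le_eq)
        finally show ?thesis using \<phi>(2)[OF t0] by linarith
      qed
      then show ?thesis unfolding t_def .
    qed
    then show "uniform_domain \<phi> G" unfolding uniform_domain_def domain_def using G conn by blast
  qed (rule \<phi>(1))
qed

section \<open>Chains on spheres\<close>

text \<open>The segment is cut into \<open>K\<close> equal pieces. The relation \<open>R\<close> is
  abstract so that it can be a chain step as well as the pullback of a sphere step under radial
  projection.\<close>

lemma segment_chain: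
  fixes u v :: "'a::euclidean_space"
  assumes R: "\<And>z w. z \<in> closed_segment u v \<Longrightarrow> w \<in> closed_segment u v \<Longrightarrow> dist z w \<le> e \<Longrightarrow> (z, w) \<in> R"
    and d: "dist u v \<le> real K * e" and K: "0 < K"
  shows "(u, v) \<in> R ^^ K"
proof -
  define p where "p k = u + (real k / real K) *\<^sub>R (v - u)" for k :: nat
  have seg: "p k \<in> closed_segment u v" if "k \<le> K" for k
  proof -
    have "p k = (1 - real k / real K) *\<^sub>R u + (real k / real K) *\<^sub>R v"
      unfolding p_def by (simp add: algebra_simps)
    then show ?thesis unfolding closed_segment_def using that K by force
  qed
  have "dist (p k) (p (Suc k)) \<le> e" for k
  proof -
    have "p (Suc k) - p k = (1 / real K) *\<^sub>R (v - u)"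
      unfolding p_def by (simp add: algebra_simps add_divide_distrib)
    then have "dist (p k) (p (Suc k)) = dist u v / real K"
      unfolding dist_commute[of "p k"] dist_commute[of u] by (simp add: dist_norm)
    then show ?thesis using d K by (simp add: pos_divide_le_eq mult.commute)
  qed
  then have "(u, p k) \<in> R ^^ k" if "k \<le> K" for k
    using that
  proof (induction k)
    case 0 then show ?case by (simp add: p_def)
  next
    case (Suc k)
    then show ?case using R[OF seg seg, of k "Suc k"] by (intro relpow_Suc_I) auto
  qed
  from this[of K] show ?thesis using K by (simp add: p_def)
qed

text \<open>Every point of the segment keeps at least half of \<open>codist G u\<close>, so pieces
  of length \<open>l * (codist G u / 2)\<close> are steps of relative size \<open>l\<close>.\<close>

lemma chain_step_refine:
  fixes u v :: "'a::euclidean_space"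
  assumes s: "(u, v) \<in> chain_step (1/2) G" and M: "1 \<le> real M * l" and l: "0 \<le> l"
  shows "(u, v) \<in> chain_step l G ^^ M"
proof (rule segment_chain[where e = "l * (codist G u / 2)"])
  have uv: "u \<in> G" "dist u v \<le> codist G u / 2" using s unfolding chain_step_def by auto
  have z: "z \<in> G \<and> codist G u / 2 \<le> codist G z" if "z \<in> closed_segment u v" for z
  proof (cases "codist G u = 0")
    \<comment> \<open>\<open>codist G u\<close> can vanish, for instance when \<open>G\<close> is
      not open; then the step is constant.\<close>
    case True
    then have "u = v" using uv by simp
    then show ?thesis using that True uv by simp
  next
    case False
    then have p: "0 < codist G u" using codist_nonneg[of G u] by linarith
    have "dist u z \<le> codist G u / 2"
      using dist_in_closed_segment[OF that] uv by (simp add: dist_commute)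
    then show ?thesis using p codist_le[of z G u] codist_triangle[of G u z] by force
  qed
  show "(z, w) \<in> chain_step l G"
    if "z \<in> closed_segment u v" "w \<in> closed_segment u v" "dist z w \<le> l * (codist G u / 2)" for z w
  proof -
    have "l * (codist G u / 2) \<le> l * codist G z" "l * (codist G u / 2) \<le> l * codist G w"
      using z[OF that(1)] z[OF that(2)] l by (simp_all only: mult_left_mono)
    then show ?thesis using z that unfolding chain_step_def by auto
  qed
  have "codist G u / 2 \<le> (real M * l) * (codist G u / 2)"
    using mult_right_mono[OF M, of "codist G u / 2"] by simp
  then show "dist u v \<le> real M * (l * (codist G u / 2))" using uv by (simp add: mult.assoc)
  show "0 < M" using M by (cases M) auto
qed

lemma relpow_subset: "R \<subseteq> S \<Longrightarrow> (x, y) \<in> R ^^ n \<Longrightarrow> (x, y) \<in> S ^^ n"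
  for R S :: "('a \<times> 'a) set"
  by (induction n arbitrary: y) auto

lemma relpow_map:
  assumes "\<And>u v. (u, v) \<in> R \<Longrightarrow> (h u, h v) \<in> S ^^ K" and "(u, v) \<in> R ^^ n"
  shows "(h u, h v) \<in> S ^^ (n * K)"
  using assms(2)
proof (induction n arbitrary: v)
  case (Suc n)
  then obtain w where "(u, w) \<in> R ^^ n" "(w, v) \<in> R" by auto
  then have "(h u, h w) \<in> S ^^ (n * K)" "(h w, h v) \<in> S ^^ K" using Suc.IH assms(1) by auto
  then show ?case using relpow_trans by (metis add.commute mult_Suc)
qed simp

text \<open>The step size is relative to the radius, so that one step count serves spheres of all
  radii.\<close>

definition sphere_step :: "real \<Rightarrow> 'a::metric_space \<Rightarrow> real \<Rightarrow> ('a \<times> 'a) set" where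
  "sphere_step e a \<rho> = {(u, v). u \<in> sphere a \<rho> \<and> v \<in> sphere a \<rho> \<and> dist u v \<le> e * \<rho>}"

text \<open>The difference of the projections is a scaled copy of \<open>x - y\<close> plus a
  multiple of \<open>y\<close> caused by the different norms; each has norm at most \<rho> |x - y| /
  |x|.\<close>

lemma dist_radial_le:
  fixes x y :: "'a::real_normed_vector"
  assumes "x \<noteq> 0" "y \<noteq> 0" "0 \<le> \<rho>"
  shows "norm ((\<rho> / norm x) *\<^sub>R x - (\<rho> / norm y) *\<^sub>R y) \<le> 2 * \<rho> / norm x * norm (x - y)"
proof -
  have "(\<rho> / norm x) *\<^sub>R x - (\<rho> / norm y) *\<^sub>R y =
      (\<rho> / norm x) *\<^sub>R (x - y) + (\<rho> / norm x * ((norm y - norm x) / norm y)) *\<^sub>R y"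
  proof -
    have c: "\<rho> / norm x * ((norm y - norm x) / norm y) = \<rho> / norm x - \<rho> / norm y"
      using assms by (simp add: field_simps)
    show ?thesis unfolding c by (simp add: algebra_simps)
  qed
  also have "norm \<dots> \<le> \<rho> / norm x * norm (x - y) + \<rho> / norm x * \<bar>norm y - norm x\<bar>"
    by (rule norm_triangle_le) (use assms in \<open>simp add: abs_mult\<close>)
  also have "\<dots> \<le> \<rho> / norm x * norm (x - y) + \<rho> / norm x * norm (x - y)"
    using norm_triangle_ineq3[of y x] assms
    by (intro add_left_mono mult_left_mono) (auto simp: norm_minus_commute)
  finally show ?thesis by (simp add: algebra_simps)
qed

text \<open>In the squared norm the mixed term is nonnegative, and (1 - t)^2 + t^2 is at least 1/2,
  of which 1/4 is kept to avoid a root. So the chord stays away from the center.\<close>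

lemma norm_segment_ge:
  fixes p q :: "'a::real_inner"
  assumes "norm p = \<rho>" "norm q = \<rho>" "0 \<le> p \<bullet> q" "0 \<le> t" "t \<le> 1"
  shows "\<rho> / 2 \<le> norm ((1 - t) *\<^sub>R p + t *\<^sub>R q)"
proof -
  have r: "p \<bullet> p = \<rho>\<^sup>2" "q \<bullet> q = \<rho>\<^sup>2" "0 \<le> \<rho>" using assms by (auto simp: dot_square_norm)
  have "(norm ((1 - t) *\<^sub>R p + t *\<^sub>R q))\<^sup>2 = ((1-t)\<^sup>2 + t\<^sup>2) * \<rho>\<^sup>2 + 2 * t * (1-t) * (p \<bullet> q)"
    unfolding power2_norm_eq_inner using r
    by (simp add: inner_add_left inner_add_right inner_commute power2_eq_square algebra_simps)
  moreover have "0 \<le> 2 * t * (1-t) * (p \<bullet> q)" using assms by simp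
  moreover have "1/4 \<le> (1-t)\<^sup>2 + t\<^sup>2"
  proof -
    have "(1-t)\<^sup>2 + t\<^sup>2 = 1/2 + 2 * (t - 1/2)\<^sup>2" by (simp add: power2_eq_square algebra_simps)
    then show ?thesis by simp
  qed
  then have "1/4 * \<rho>\<^sup>2 \<le> ((1-t)\<^sup>2 + t\<^sup>2) * \<rho>\<^sup>2" by (intro mult_right_mono) auto
  ultimately have "(\<rho>/2)\<^sup>2 \<le> (norm ((1 - t) *\<^sub>R p + t *\<^sub>R q))\<^sup>2" by (simp add: power_divide)
  then show ?thesis using power2_le_imp_le norm_ge_zero by blast
qed

text \<open>The chord is projected radially. As it keeps distance \<rho>/2 from the center, the
  projection expands distances on it at most 4 times, so chord steps of
  \<open>e * \<rho> / 4\<close> are short enough; the chord has length at most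
  \<open>2 * \<rho>\<close>, which gives \<open>8 / e\<close> steps.\<close>

lemma sphere_chain_acute:
  fixes a p q :: "'a::euclidean_space"
  assumes \<rho>: "0 < \<rho>" and e: "0 < e" and K: "8 / e \<le> real K"
    and p: "p \<in> sphere a \<rho>" and q: "q \<in> sphere a \<rho>" and pq: "0 \<le> (p - a) \<bullet> (q - a)"
  shows "(p, q) \<in> sphere_step e a \<rho> ^^ K"
proof -
  define f where "f z = a + (\<rho> / norm (z - a)) *\<^sub>R (z - a)" for z
  define R where "R = {(z, w). (f z, f w) \<in> sphere_step e a \<rho>}"
  have np: "norm (p - a) = \<rho>" "norm (q - a) = \<rho>"
    using p q by (auto simp: dist_norm norm_minus_commute)
  have big: "\<rho> / 2 \<le> norm (z - a)" if "z \<in> closed_segment p q" for z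
  proof -
    obtain t where t: "z = (1 - t) *\<^sub>R p + t *\<^sub>R q" "0 \<le> t" "t \<le> 1"
      using \<open>z \<in> closed_segment p q\<close> unfolding closed_segment_def by auto
    then have "z - a = (1 - t) *\<^sub>R (p - a) + t *\<^sub>R (q - a)" by (simp add: algebra_simps)
    then show ?thesis using norm_segment_ge[OF np pq t(2,3)] by simp
  qed
  have "(p, q) \<in> R ^^ K"
  proof (rule segment_chain[where e = "e * \<rho> / 4"])
    fix z w assume z: "z \<in> closed_segment p q" and w: "w \<in> closed_segment p q"
      and d: "dist z w \<le> e * \<rho> / 4"
    have nz: "z - a \<noteq> 0" "w - a \<noteq> 0" using big[OF z] big[OF w] \<rho> by auto
    have "dist (f z) (f w) \<le> 2 * \<rho> / norm (z - a) * norm (z - w)"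
      using dist_radial_le[OF nz, of \<rho>] \<rho> unfolding f_def dist_norm by simp
    also have "\<dots> \<le> 4 * norm (z - w)"
      using big[OF z] nz \<rho> by (intro mult_right_mono) (auto simp: pos_divide_le_eq)
    finally have "dist (f z) (f w) \<le> e * \<rho>" using d by (simp add: dist_norm)
    moreover have "f z \<in> sphere a \<rho>" "f w \<in> sphere a \<rho>"
      using nz \<rho> unfolding f_def by (auto simp: dist_norm)
    ultimately show "(z, w) \<in> R" unfolding R_def sphere_step_def by simp
  next
    have "dist p q \<le> 2 * \<rho>" using p q dist_triangle[of p q a] by (simp add: dist_commute)
    also have "\<dots> \<le> real K * (e * \<rho> / 4)" using K e \<rho> by (simp add: field_simps)
    finally show "dist p q \<le> real K * (e * \<rho> / 4)" .
    have "0 < 8 / e" using e by simp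
    then show "0 < K" using K by (metis of_nat_0_less_iff order_less_le_trans)
  qed
  then have "(f p, f q) \<in> sphere_step e a \<rho> ^^ (K * 1)"
    by (rule relpow_map[rotated]) (simp add: R_def)
  moreover have "f p = p" "f q = q" unfolding f_def np using \<rho> by auto
  ultimately show ?thesis by simp
qed

text \<open>Arbitrary points are joined through a third one. In dimension at least 2 there is a
  direction orthogonal to \<open>p - a\<close>; with the right sign it forms no obtuse angle with
  \<open>q - a\<close> either.\<close>

lemma sphere_chain:
  assumes dim: "2 \<le> DIM('a::euclidean_space)" and e: "0 < e"
  obtains K where "1 \<le> K"
    "\<And>(a::'a) \<rho> p q. 0 < \<rho> \<Longrightarrow> p \<in> sphere a \<rho> \<Longrightarrow> q \<in> sphere a \<rho> \<Longrightarrow>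
      (p, q) \<in> sphere_step e a \<rho> ^^ K"
proof -
  obtain K where K: "8 / e \<le> real K" using real_arch_simple by blast
  have "0 < 8 / e" using e by simp
  then have K1: "1 \<le> K" using K by (cases K) auto
  show thesis
  proof (rule that[of "K + K"])
    fix a :: 'a and \<rho> p q assume \<rho>: "0 < \<rho>" and p: "p \<in> sphere a \<rho>" and q: "q \<in> sphere a \<rho>"
    obtain y where y: "y \<noteq> 0" "orthogonal (p - a) y" using orthogonal_to_vector_exists[OF dim] by blast
    define w where "w = (if 0 \<le> y \<bullet> (q - a) then \<rho> / norm y else - \<rho> / norm y) *\<^sub>R y"
    have w: "norm w = \<rho>" "(p - a) \<bullet> w = 0"
      using y \<rho> unfolding w_def orthogonal_def by auto
    have w': "0 \<le> w \<bullet> (q - a)"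
      using y \<rho> unfolding w_def by (auto simp: divide_simps mult_nonneg_nonpos)
    have "(p, a + w) \<in> sphere_step e a \<rho> ^^ K"
      by (rule sphere_chain_acute[OF \<rho> e K p]) (use w in \<open>auto simp: dist_norm\<close>)
    moreover have "(a + w, q) \<in> sphere_step e a \<rho> ^^ K"
      by (rule sphere_chain_acute[OF \<rho> e K _ q]) (use w w' in \<open>auto simp: dist_norm\<close>)
    ultimately show "(p, q) \<in> sphere_step e a \<rho> ^^ (K + K)" by (rule relpow_trans)
  qed (use K1 in simp)
qed

lemma sphere_nearest:
  fixes a z :: "'a::euclidean_space"
  assumes "0 \<le> \<rho>"
  shows "\<exists>p\<in>sphere a \<rho>. dist z p = \<bar>dist a z - \<rho>\<bar>"
proof (cases "z = a")
  case True
  obtain w :: 'a where "norm w = \<rho>" using vector_choose_size[OF assms] by blast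
  then show ?thesis using True by (intro bexI[of _ "a + w"]) (auto simp: dist_norm)
next
  case False
  define p where "p = a + (\<rho> / norm (z - a)) *\<^sub>R (z - a)"
  have n: "0 < norm (z - a)" using False by simp
  have "z - p = (1 - \<rho> / norm (z - a)) *\<^sub>R (z - a)" unfolding p_def by (simp add: algebra_simps)
  then have "dist z p = \<bar>1 - \<rho> / norm (z - a)\<bar> * norm (z - a)" by (simp add: dist_norm)
  also have "\<dots> = \<bar>(1 - \<rho> / norm (z - a)) * norm (z - a)\<bar>" by (simp add: abs_mult)
  also have "(1 - \<rho> / norm (z - a)) * norm (z - a) = norm (z - a) - \<rho>" using n by (simp add: field_simps)
  finally have "dist z p = \<bar>dist a z - \<rho>\<bar>" by (simp add: dist_norm norm_minus_commute)
  moreover have "p \<in> sphere a \<rho>" using n assms unfolding p_def by (simp add: dist_norm)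
  ultimately show ?thesis by blast
qed

section \<open>Removing separated sets\<close>

text \<open>Points of the chain outside all \<open>H i\<close> stay, those in \<open>H i\<close> are
  pushed to its sphere; \<open>proj\<close> says that this moves them no farther than to any point
  outside \<open>H i\<close>. The sets \<open>H i\<close> are abstract because they are balls for
  chains of the domain, but the exterior of one ball for chains of the complement of a removed
  set.\<close>

lemma chain_transport:
  fixes X G :: "'a::euclidean_space set" and H :: "'i \<Rightarrow> 'a set"
  assumes \<eta>: "0 < \<eta>" "\<eta> \<le> 1"
    and K1: "1 \<le> K"
    and K: "\<And>(a::'a) \<rho> p q. 0 < \<rho> \<Longrightarrow> p \<in> sphere a \<rho> \<Longrightarrow> q \<in> sphere a \<rho> \<Longrightarrow>
      (p, q) \<in> sphere_step (\<eta>/2) a \<rho> ^^ K"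
    and out: "\<And>z. z \<in> X \<Longrightarrow> (\<And>i. i \<in> I \<Longrightarrow> z \<notin> H i) \<Longrightarrow> z \<in> G \<and> \<eta> * codist X z \<le> codist G z"
    and R: "\<And>i. i \<in> I \<Longrightarrow> 0 < R i"
    and sph: "\<And>i z. i \<in> I \<Longrightarrow> z \<in> sphere (a i) (R i) \<Longrightarrow> z \<in> G \<and> \<eta> * R i \<le> codist G z"
    and proj: "\<And>i v. i \<in> I \<Longrightarrow> v \<in> H i \<Longrightarrow> \<exists>p\<in>sphere (a i) (R i). \<forall>u. u \<notin> H i \<longrightarrow> dist v p \<le> dist u v"
    and size: "\<And>i u v. i \<in> I \<Longrightarrow> u \<in> X \<Longrightarrow> v \<in> X \<Longrightarrow> u \<notin> H i \<Longrightarrow> v \<in> H i \<Longrightarrow>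
      \<eta> * min (codist X u) (codist X v) \<le> R i"
    and sep: "\<And>i j u v. i \<in> I \<Longrightarrow> j \<in> I \<Longrightarrow> u \<in> H i \<Longrightarrow> v \<in> H j \<Longrightarrow>
      (u, v) \<in> chain_step (\<eta>\<^sup>2/4) X \<Longrightarrow> i = j"
    and x: "x \<in> X" "\<And>i. i \<in> I \<Longrightarrow> x \<notin> H i" and y: "y \<in> X" "\<And>i. i \<in> I \<Longrightarrow> y \<notin> H i"
    and ch: "(x, y) \<in> chain_step (\<eta>\<^sup>2/4) X ^^ n"
  shows "(x, y) \<in> chain_step (1/2) G ^^ (n * K)"
proof -
  obtain \<pi> where \<pi>: "\<And>i v. i \<in> I \<Longrightarrow> v \<in> H i \<Longrightarrow> \<pi> i v \<in> sphere (a i) (R i)"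
    "\<And>i v u. i \<in> I \<Longrightarrow> v \<in> H i \<Longrightarrow> u \<notin> H i \<Longrightarrow> dist v (\<pi> i v) \<le> dist u v"
    using proj by metis
  \<comment> \<open>The pushing map. For points of \<open>X\<close> the chosen index is unique, by
    \<open>sep\<close> applied to a constant step.\<close>
  define Q where "Q z = (if \<exists>i\<in>I. z \<in> H i then \<pi> (SOME i. i \<in> I \<and> z \<in> H i) z else z)" for z
  have Qin: "\<exists>i\<in>I. z \<in> H i \<and> Q z = \<pi> i z" if "\<exists>i\<in>I. z \<in> H i" for z
    using that someI_ex[of "\<lambda>i. i \<in> I \<and> z \<in> H i"] unfolding Q_def by auto
  have Qout: "Q z = z" if "\<not> (\<exists>i\<in>I. z \<in> H i)" for z using that unfolding Q_def by auto
  \<comment> \<open>A step that enters a hole. Pushing \<open>v\<close> at most doubles it. In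
    \<open>\<eta>\<^sup>2/4\<close> one factor \<eta> turns \<open>codist X\<close> into
    \<open>codist G u\<close> or \<open>R i\<close>, the other turns \<open>R i\<close> into
    \<open>codist G (Q v)\<close>, and 1/4 pays for the doubling and the final 1/2.\<close>
  have mixed: "(u, Q v) \<in> chain_step (1/2) G ^^ K"
    if uv: "(u, v) \<in> chain_step (\<eta>\<^sup>2/4) X" and u: "\<not> (\<exists>i\<in>I. u \<in> H i)" and v: "\<exists>i\<in>I. v \<in> H i" for u v
  proof -
    have X: "u \<in> X" "v \<in> X" and d: "dist u v \<le> \<eta>\<^sup>2/4 * codist X u" "dist u v \<le> \<eta>\<^sup>2/4 * codist X v"
      using uv unfolding chain_step_def by auto
    obtain i where i: "i \<in> I" "v \<in> H i" and Q: "Q v = \<pi> i v" using Qin[OF v] by blast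
    have uG: "u \<in> G" "\<eta> * codist X u \<le> codist G u" using out[OF X(1)] u by auto
    have vG: "Q v \<in> G" "\<eta> * R i \<le> codist G (Q v)" using sph[OF i(1) \<pi>(1)[OF i]] Q by auto
    have "dist v (Q v) \<le> dist u v" using \<pi>(2)[OF i, of u] u i Q by auto
    then have d2: "dist u (Q v) \<le> 2 * dist u v" using dist_triangle[of u "Q v" v] by linarith
    have "2 * dist u v \<le> \<eta>/2 * (\<eta> * codist X u)" using d(1) by (simp add: power2_eq_square)
    also have "\<dots> \<le> \<eta>/2 * codist G u" using uG(2) \<eta> by (intro mult_left_mono) auto
    also have "\<dots> \<le> 1/2 * codist G u" using \<eta> by (intro mult_right_mono) auto
    finally have 1: "dist u (Q v) \<le> 1/2 * codist G u" using d2 by linarith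
    have "2 * dist u v \<le> \<eta>\<^sup>2/2 * min (codist X u) (codist X v)"
      using d by (simp add: min_def)
    also have "\<dots> = \<eta>/2 * (\<eta> * min (codist X u) (codist X v))" by (simp add: power2_eq_square)
    also have "\<dots> \<le> \<eta>/2 * R i" using size[OF i(1) X _ i(2)] u i \<eta> by (intro mult_left_mono) auto
    also have "\<dots> \<le> 1/2 * codist G (Q v)" using vG by simp
    finally have 2: "dist u (Q v) \<le> 1/2 * codist G (Q v)" using d2 by linarith
    have "(u, Q v) \<in> chain_step (1/2) G ^^ 1"
      using 1 2 uG vG unfolding chain_step_def by simp
    then show ?thesis by (rule chain_pad) (use vG K1 in auto)
  qed
  have one: "(Q u, Q v) \<in> chain_step (1/2) G ^^ K" if uv: "(u, v) \<in> chain_step (\<eta>\<^sup>2/4) X" for u v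
  proof (cases "\<exists>i\<in>I. u \<in> H i"; cases "\<exists>i\<in>I. v \<in> H i")
    \<comment> \<open>By \<open>sep\<close> both endpoints lie in the same hole, and
      \<open>K\<close> steps along its sphere join their images wherever these lie.\<close>
    assume u: "\<exists>i\<in>I. u \<in> H i" and v: "\<exists>i\<in>I. v \<in> H i"
    obtain i where i: "i \<in> I" "u \<in> H i" "Q u = \<pi> i u" using Qin[OF u] by blast
    obtain j where j: "j \<in> I" "v \<in> H j" "Q v = \<pi> j v" using Qin[OF v] by blast
    have ij: "j = i" using sep[OF i(1) j(1) i(2) j(2) uv] by simp
    have "(Q u, Q v) \<in> sphere_step (\<eta>/2) (a i) (R i) ^^ K"
      by (rule K) (use R \<pi>(1) i j ij in auto)
    moreover have "sphere_step (\<eta>/2) (a i) (R i) \<subseteq> chain_step (1/2) G"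
    proof (clarsimp simp: sphere_step_def chain_step_def simp del: mem_sphere)
      fix z w assume zw: "z \<in> sphere (a i) (R i)" "w \<in> sphere (a i) (R i)" "dist z w * 2 \<le> \<eta> * R i"
      then show "z \<in> G \<and> w \<in> G \<and> dist z w * 2 \<le> codist G z \<and> dist z w * 2 \<le> codist G w"
        using sph[OF i(1) zw(1)] sph[OF i(1) zw(2)] by auto
    qed
    ultimately show ?thesis by (rule relpow_subset[rotated])
  next
    assume u: "\<exists>i\<in>I. u \<in> H i" and v: "\<not> (\<exists>i\<in>I. v \<in> H i)"
    then show ?thesis using chain_sym[OF mixed[OF chain_step_sym[OF uv] v u]] Qout[OF v] by simp
  next
    assume u: "\<not> (\<exists>i\<in>I. u \<in> H i)" and v: "\<exists>i\<in>I. v \<in> H i"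
    then show ?thesis using mixed[OF uv u v] Qout[OF u] by simp
  next
    assume u: "\<not> (\<exists>i\<in>I. u \<in> H i)" and v: "\<not> (\<exists>i\<in>I. v \<in> H i)"
    have X: "u \<in> X" "v \<in> X" and d: "dist u v \<le> \<eta>\<^sup>2/4 * codist X u" "dist u v \<le> \<eta>\<^sup>2/4 * codist X v"
      using uv unfolding chain_step_def by auto
    have le: "\<eta>\<^sup>2/4 * codist X z \<le> 1/2 * codist G z" if z: "\<eta> * codist X z \<le> codist G z" for z
    proof -
      have "\<eta>\<^sup>2/4 * codist X z = \<eta>/4 * (\<eta> * codist X z)" by (simp add: power2_eq_square)
      also have "\<dots> \<le> \<eta>/4 * codist G z" using z \<eta> by (intro mult_left_mono) auto
      also have "\<dots> \<le> 1/2 * codist G z" using \<eta> by (intro mult_right_mono) auto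
      finally show ?thesis .
    qed
    have o: "u \<in> G" "\<eta> * codist X u \<le> codist G u" "v \<in> G" "\<eta> * codist X v \<le> codist G v"
      using out[OF X(1)] out[OF X(2)] u v by auto
    have "dist u v \<le> 1/2 * codist G u" "dist u v \<le> 1/2 * codist G v"
      using d le[OF o(2)] le[OF o(4)] by linarith+
    then have "(u, v) \<in> chain_step (1/2) G ^^ 1" using o unfolding chain_step_def by simp
    then have "(u, v) \<in> chain_step (1/2) G ^^ K"
      by (rule chain_pad) (use out[OF X(2)] v K1 in auto)
    then show ?thesis using Qout u v by simp
  qed
  have "(Q x, Q y) \<in> chain_step (1/2) G ^^ (n * K)" by (rule relpow_map[OF one ch])
  then show ?thesis using Qout[of x] Qout[of y] x y by auto
qed

lemma chain_refine:
  fixes x y :: "'a::euclidean_space"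
  assumes "(x, y) \<in> chain_step (1/2) G ^^ n" "1 \<le> real M * l" "0 \<le> l"
  shows "(x, y) \<in> chain_step l G ^^ (n * M)"
  using relpow_map[of "chain_step (1/2) G" "\<lambda>u. u"] chain_step_refine assms by blast

lemma dist_closed_segment_le:
  fixes x y u v :: "'a::euclidean_space"
  assumes "u \<in> closed_segment x y" "v \<in> closed_segment x y"
  shows "dist u v \<le> dist x y"
proof -
  obtain s where s: "u = (1 - s) *\<^sub>R x + s *\<^sub>R y" "0 \<le> s" "s \<le> 1"
    using assms(1) unfolding closed_segment_def by auto
  obtain r where r: "v = (1 - r) *\<^sub>R x + r *\<^sub>R y" "0 \<le> r" "r \<le> 1"
    using assms(2) unfolding closed_segment_def by auto
  have "u - v = (r - s) *\<^sub>R (x - y)" unfolding s r by (simp add: algebra_simps)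
  then have "dist u v = \<bar>r - s\<bar> * dist x y" by (simp add: dist_norm)
  also have "\<dots> \<le> 1 * dist x y" using s r by (intro mult_right_mono) auto
  finally show ?thesis by simp
qed

text \<open>The numbers \<open>K\<close> and \<open>M\<close> depend only on \<open>\<eta>\<close> and the dimension, hence so does the bound obtained for
  \<open>G\<close>: \<open>K\<close> steps suffice on a sphere, and \<open>M\<close> is the cost of refining a chain to steps of relative size
  \<open>\<eta>\<^sup>2/4\<close>.\<close>

locale hole_system =
  fixes \<eta> :: real and D :: "'a::euclidean_space set" and I :: "'i set"
    and a :: "'i \<Rightarrow> 'a" and R :: "'i \<Rightarrow> real" and E :: "'i \<Rightarrow> 'a set" and K M :: nat and G :: "'a set"
  assumes \<eta>: "0 < \<eta>" "\<eta> \<le> 1/2"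
    and G_def: "G = D - (\<Union>i\<in>I. E i)"
    and D: "D \<noteq> UNIV"
    and R: "i \<in> I \<Longrightarrow> 0 < R i"
    and E: "i \<in> I \<Longrightarrow> E i \<noteq> {}" "i \<in> I \<Longrightarrow> E i \<subseteq> ball (a i) (R i)"
    and cball_D: "i \<in> I \<Longrightarrow> cball (a i) (R i) \<subseteq> D"
    and outside: "z \<in> D \<Longrightarrow> (\<And>i. i \<in> I \<Longrightarrow> z \<notin> ball (a i) (R i)) \<Longrightarrow> \<eta> * codist D z \<le> codist G z"
    and inside: "i \<in> I \<Longrightarrow> z \<in> cball (a i) (R i) \<Longrightarrow> z \<notin> E i \<Longrightarrow> \<eta> * infdist z (E i) \<le> codist G z"
    and on_sphere: "i \<in> I \<Longrightarrow> z \<in> sphere (a i) (R i) \<Longrightarrow> \<eta> * R i \<le> codist G z"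
    and size: "i \<in> I \<Longrightarrow> z \<in> ball (a i) (R i) \<Longrightarrow> \<eta> * codist D z \<le> R i"
    and separated: "i \<in> I \<Longrightarrow> j \<in> I \<Longrightarrow> i \<noteq> j \<Longrightarrow> z \<in> cball (a i) (R i) \<Longrightarrow> w \<in> cball (a j) (R j) \<Longrightarrow>
      \<eta> * R i \<le> dist z w"
    and K1: "1 \<le> K"
    and K: "\<And>(b::'a) \<rho> p q. 0 < \<rho> \<Longrightarrow> p \<in> sphere b \<rho> \<Longrightarrow> q \<in> sphere b \<rho> \<Longrightarrow>
      (p, q) \<in> sphere_step (\<eta>/2) b \<rho> ^^ K"
    and M: "1 \<le> real M * (\<eta>\<^sup>2/4)"
begin

lemma cball_disjoint:
  assumes "i \<in> I" "j \<in> I" "z \<in> cball (a i) (R i)" "z \<in> cball (a j) (R j)"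
  shows "i = j"
proof (rule ccontr)
  assume "i \<noteq> j"
  then have "\<eta> * R i \<le> 0" using separated[OF assms(1,2) _ assms(3,4)] by simp
  moreover have "0 < \<eta> * R i" using R[OF assms(1)] \<eta> by simp
  ultimately show False by linarith
qed

lemma cball_in_G:
  assumes "i \<in> I" "z \<in> cball (a i) (R i)" "z \<notin> E i"
  shows "z \<in> G"
proof -
  have "z \<notin> E j" if "j \<in> I" for j
    using cball_disjoint[OF assms(1) that assms(2)] E(2)[OF that] assms(3) by (metis ball_subset_cball subsetD)
  then show ?thesis unfolding G_def using assms cball_D by blast
qed

lemma sphere_in_G:
  assumes "i \<in> I" "z \<in> sphere (a i) (R i)" shows "z \<in> G" "z \<notin> E i"
proof -
  show "z \<notin> E i" using E(2)[OF assms(1)] assms(2) by force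
  then show "z \<in> G" using cball_in_G[OF assms(1)] assms(2) by auto
qed

lemma infdist_E_le:
  assumes "i \<in> I" "z \<in> cball (a i) (R i)" shows "infdist z (E i) \<le> 2 * R i"
proof -
  obtain e where e: "e \<in> E i" using E(1)[OF assms(1)] by blast
  then have "dist (a i) e < R i" using E(2)[OF assms(1)] by auto
  then have "dist z e \<le> 2 * R i" using assms(2) dist_triangle[of z e "a i"] by (simp add: dist_commute)
  then show ?thesis using infdist_le2[OF e] by blast
qed

lemma codist_le_infdist: "i \<in> I \<Longrightarrow> codist G z \<le> infdist z (E i)"
  using codist_subset[of G "- E i" z] E(1)[of i] unfolding G_def codist_def by auto

text \<open>The chain of \<open>D\<close> supplied by \<open>f\<close> is refined and pushed out of
  all balls; since \<open>codist G\<close> is at most \<open>codist D\<close>, the bound by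
  \<open>t\<close> also holds in \<open>D\<close>.\<close>

lemma chain_outside:
  assumes f: "chain_uniform f D"
    and x: "x \<in> D" "\<And>i. i \<in> I \<Longrightarrow> x \<notin> ball (a i) (R i)"
    and y: "y \<in> D" "\<And>i. i \<in> I \<Longrightarrow> y \<notin> ball (a i) (R i)"
    and d: "dist x y \<le> t * codist G x" "dist x y \<le> t * codist G y" "0 \<le> t"
  shows "(x, y) \<in> chain_step (1/2) G ^^ (f t * M * K)"
proof (rule chain_transport[where X = D and H = "\<lambda>i. ball (a i) (R i)" and a = a and R = R and I = I and \<eta> = \<eta>])
  have sub: "codist G z \<le> codist D z" for z
    by (rule codist_subset) (use D in \<open>auto simp: G_def\<close>)
  have "t * codist G z \<le> t * codist D z" for z using sub d(3) by (rule mult_left_mono)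
  then have "(x, y) \<in> chain_step (1/2) D ^^ f t"
    using f x(1) y(1) d unfolding chain_uniform_def by (meson order_trans)
  then show "(x, y) \<in> chain_step (\<eta>\<^sup>2/4) D ^^ (f t * M)" by (rule chain_refine[OF _ M]) simp
  show "0 < \<eta>" "\<eta> \<le> 1" using \<eta> by auto
  show "1 \<le> K" by (rule K1)
  show "z \<in> G \<and> \<eta> * codist D z \<le> codist G z"
    if "z \<in> D" "\<And>i. i \<in> I \<Longrightarrow> z \<notin> ball (a i) (R i)" for z
    using outside[OF that] that E(2) unfolding G_def by blast
  show "z \<in> G \<and> \<eta> * R i \<le> codist G z" if "i \<in> I" "z \<in> sphere (a i) (R i)" for i z
    using sphere_in_G on_sphere that by blast
  show "\<exists>p\<in>sphere (a i) (R i). \<forall>u. u \<notin> ball (a i) (R i) \<longrightarrow> dist v p \<le> dist u v"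
    if i: "i \<in> I" and v: "v \<in> ball (a i) (R i)" for i v
  proof -
    obtain p where p: "p \<in> sphere (a i) (R i)" "dist v p = \<bar>dist (a i) v - R i\<bar>"
      using sphere_nearest[of "R i" "a i" v] R[OF i] by auto
    have "dist v p \<le> dist u v" if "u \<notin> ball (a i) (R i)" for u
      using p(2) v that dist_triangle[of "a i" u v] by (simp add: dist_commute)
    then show ?thesis using p(1) by blast
  qed
  show "\<eta> * min (codist D u) (codist D v) \<le> R i"
    if i: "i \<in> I" and v: "v \<in> ball (a i) (R i)" for i u v
  proof -
    have "\<eta> * min (codist D u) (codist D v) \<le> \<eta> * codist D v" using \<eta> by (intro mult_left_mono) auto
    then show ?thesis using size[OF i v] by linarith
  qed
  \<comment> \<open>By \<open>size\<close> a refined step from ball \<open>i\<close> has length at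
    most \<open>\<eta>/4 * R i\<close>, less than the gap \<open>\<eta> * R i\<close> between the
    balls.\<close>
  show "i = j" if ij: "i \<in> I" "j \<in> I" and u: "u \<in> ball (a i) (R i)" and v: "v \<in> ball (a j) (R j)"
    and s: "(u, v) \<in> chain_step (\<eta>\<^sup>2/4) D" for i j u v
  proof (rule ccontr)
    assume "i \<noteq> j"
    then have "\<eta> * R i \<le> dist u v" using separated[OF ij, of u v] u v by auto
    also have "dist u v \<le> \<eta>/4 * (\<eta> * codist D u)"
      using s unfolding chain_step_def by (auto simp: power2_eq_square)
    also have "\<dots> \<le> \<eta>/4 * R i" using size[OF ij(1) u] \<eta> by (intro mult_left_mono) auto
    finally have "\<eta> * R i \<le> 0" by simp
    moreover have "0 < \<eta> * R i" using R[OF ij(1)] \<eta> by simp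
    ultimately show False by linarith
  qed
qed (use K R x y in auto)

text \<open>The roles are reversed: a chain of the complement of \<open>E i\<close> may leave
  \<open>D\<close> or run into other \<open>E j\<close>, so all that lies beyond the closed ball is
  pushed back to its sphere. With a single index the separation condition is trivial.\<close>

lemma chain_inside:
  assumes i: "i \<in> I" and g: "chain_uniform g (- E i)"
    and x: "x \<in> cball (a i) (R i)" "x \<notin> E i" and y: "y \<in> cball (a i) (R i)" "y \<notin> E i"
    and d: "dist x y \<le> t * infdist x (E i)" "dist x y \<le> t * infdist y (E i)"
  shows "(x, y) \<in> chain_step (1/2) G ^^ (g t * M * K)"
proof (rule chain_transport[where X = "- E i" and H = "\<lambda>_. - cball (a i) (R i)" and a = "\<lambda>_. a i"
      and R = "\<lambda>_. R i" and I = "{()}" and \<eta> = \<eta>])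
  have co: "codist (- E i) z = infdist z (E i)" for z unfolding codist_def by simp
  have "(x, y) \<in> chain_step (1/2) (- E i) ^^ g t"
    using g x(2) y(2) d co unfolding chain_uniform_def by auto
  then show "(x, y) \<in> chain_step (\<eta>\<^sup>2/4) (- E i) ^^ (g t * M)" by (rule chain_refine[OF _ M]) simp
  show "0 < \<eta>" "\<eta> \<le> 1" using \<eta> by auto
  show "1 \<le> K" by (rule K1)
  show "z \<in> G \<and> \<eta> * codist (- E i) z \<le> codist G z"
    if "z \<in> - E i" "\<And>j. j \<in> {()} \<Longrightarrow> z \<notin> - cball (a i) (R i)" for z
    using inside[OF i, of z] cball_in_G[OF i, of z] that co by auto
  show "z \<in> G \<and> \<eta> * R i \<le> codist G z" if "z \<in> sphere (a i) (R i)" for z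
    using sphere_in_G on_sphere that i by blast
  show "\<exists>p\<in>sphere (a i) (R i). \<forall>u. u \<notin> - cball (a i) (R i) \<longrightarrow> dist v p \<le> dist u v"
    if v: "v \<in> - cball (a i) (R i)" for v
  proof -
    obtain p where p: "p \<in> sphere (a i) (R i)" "dist v p = \<bar>dist (a i) v - R i\<bar>"
      using sphere_nearest[of "R i" "a i" v] R[OF i] by auto
    have "dist v p \<le> dist u v" if "u \<notin> - cball (a i) (R i)" for u
      using p(2) v that dist_triangle[of "a i" v u] by (simp add: dist_commute)
    then show ?thesis using p(1) by blast
  qed
  show "\<eta> * min (codist (- E i) u) (codist (- E i) v) \<le> R i"
    if u: "u \<notin> - cball (a i) (R i)" for u v
  proof -
    have "\<eta> * min (codist (- E i) u) (codist (- E i) v) \<le> \<eta> * infdist u (E i)"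
      using \<eta> co by (intro mult_left_mono) auto
    also have "\<dots> \<le> \<eta> * (2 * R i)" using infdist_E_le[OF i, of u] u \<eta> by (intro mult_left_mono) auto
    \<comment> \<open>Here \<open>\<eta> \<le> 1/2\<close> compensates the factor 2 from
      \<open>infdist_E_le\<close>.\<close>
    also have "\<dots> \<le> 1/2 * (2 * R i)" using \<eta> R[OF i] by (intro mult_right_mono) auto
    finally show ?thesis by simp
  qed
qed (use K R[OF i] x y in auto)

text \<open>If \<open>x\<close> lies in a ball that does not contain \<open>y\<close>, take for
  \<open>z\<close> a point where the segment meets the sphere. There \<open>codist G z\<close> is at
  least \<open>\<eta> * R i\<close>, while \<open>codist G x \<le> 2 * R i\<close>, so passing to
  \<open>z\<close> worsens the ratio by at most \<open>2 / \<eta>\<close>. If \<open>x\<close> lies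
  in no ball, take \<open>z = x\<close>.\<close>

lemma escape_hole:
  assumes g: "\<And>i. i \<in> I \<Longrightarrow> chain_uniform g (- E i)"
    and x: "x \<in> G" and y: "y \<in> G" and d: "dist x y \<le> t * codist G x" and t: "0 \<le> t"
    and apart: "\<not> (\<exists>i\<in>I. x \<in> ball (a i) (R i) \<and> y \<in> ball (a i) (R i))"
  shows "\<exists>z\<in>closed_segment x y. z \<in> D \<and> (\<forall>i\<in>I. z \<notin> ball (a i) (R i)) \<and> codist G x \<le> 2 / \<eta> * codist G z \<and>
    (x, z) \<in> chain_step (1/2) G ^^ (g (2 * t / \<eta>) * M * K)"
proof (cases "\<exists>i\<in>I. x \<in> ball (a i) (R i)")
  case False
  have "(x, x) \<in> chain_step (1/2) G ^^ (g (2 * t / \<eta>) * M * K)"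
    by (rule chain_pad[where m = 0]) (use x in auto)
  moreover have "1 * codist G x \<le> 2 / \<eta> * codist G x"
    using \<eta> by (intro mult_right_mono) (auto simp: pos_le_divide_eq)
  ultimately show ?thesis using False x by (intro bexI[of _ x]) (auto simp: G_def)
next
  case True
  then obtain i where i: "i \<in> I" and xi: "x \<in> ball (a i) (R i)" by blast
  have "closed_segment x y \<inter> frontier (ball (a i) (R i)) \<noteq> {}"
    by (rule connected_Int_frontier) (use xi apart i in auto)
  then obtain z where z: "z \<in> closed_segment x y" "z \<in> sphere (a i) (R i)"
    using R[OF i] by (auto simp: frontier_ball)
  have zc: "z \<in> cball (a i) (R i)" using z(2) by auto
  have zG: "z \<in> G" "z \<notin> E i" using sphere_in_G[OF i z(2)] by auto
  have zout: "z \<notin> ball (a j) (R j)" if "j \<in> I" for j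
    using cball_disjoint[OF i that zc] z(2) by force
  have "codist G x \<le> 2 * R i"
    using codist_le_infdist[OF i, of x] infdist_E_le[OF i, of x] xi by (simp add: less_imp_le)
  moreover have "2 * R i \<le> 2 / \<eta> * codist G z"
    using on_sphere[OF i z(2)] \<eta> by (simp add: field_simps)
  ultimately have cz: "codist G x \<le> 2 / \<eta> * codist G z" by linarith
  have "dist x z \<le> dist x y" using dist_in_closed_segment[OF z(1)] by (simp add: dist_commute)
  then have d1: "dist x z \<le> t * codist G x" using d by linarith
  have "t * codist G x \<le> t * (2 / \<eta> * codist G z)" using cz t by (rule mult_left_mono)
  also have "\<dots> = 2 * t / \<eta> * codist G z" by simp
  also have "\<dots> \<le> 2 * t / \<eta> * infdist z (E i)"
    using codist_le_infdist[OF i] t \<eta> by (intro mult_left_mono) auto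
  finally have dz: "dist x z \<le> 2 * t / \<eta> * infdist z (E i)" using d1 by linarith
  have "t * codist G x \<le> t * infdist x (E i)" using codist_le_infdist[OF i] t by (rule mult_left_mono)
  also have "\<dots> \<le> 2 * t / \<eta> * infdist x (E i)"
    using t \<eta> mult_left_mono[of \<eta> 2 t] by (intro mult_right_mono) (auto simp: infdist_nonneg pos_le_divide_eq)
  finally have dx: "dist x z \<le> 2 * t / \<eta> * infdist x (E i)" using d1 by linarith
  have "(x, z) \<in> chain_step (1/2) G ^^ (g (2 * t / \<eta>) * M * K)"
    by (rule chain_inside[OF i g[OF i] _ _ zc zG(2) dx dz]) (use xi x i in \<open>auto simp: G_def\<close>)
  then show ?thesis using z(1) zG(1) zout cz by (intro bexI[of _ z]) (auto simp: G_def)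
qed

text \<open>Points of one ball are joined inside it. Otherwise both escape along their segment to
  points \<open>u\<close>, \<open>v\<close> outside all balls, no farther apart than
  \<open>x\<close> and \<open>y\<close>, which are joined by a pushed chain of \<open>D\<close>. The
  bound adds up both cases, so padding covers either.\<close>

theorem chain_uniform_remove_holes:
  assumes f: "chain_uniform f D" and g: "\<And>i. i \<in> I \<Longrightarrow> chain_uniform g (- E i)"
    and pos: "\<And>z. z \<in> G \<Longrightarrow> 0 < codist G z"
  shows "chain_uniform (\<lambda>t. g t * M * K + (g (2*t/\<eta>) * M * K + f (2*t/\<eta>) * M * K + g (2*t/\<eta>) * M * K)) G"
  unfolding chain_uniform_def
proof (intro ballI allI impI)
  fix x y t assume x: "x \<in> G" and y: "y \<in> G"
    and d: "dist x y \<le> t * codist G x" "dist x y \<le> t * codist G y"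
  have "0 \<le> t * codist G x" using d(1) zero_le_dist[of x y] by linarith
  then have t: "0 \<le> t" using pos[OF x] by (simp add: zero_le_mult_iff)
  let ?b = "g (2*t/\<eta>) * M * K + f (2*t/\<eta>) * M * K + g (2*t/\<eta>) * M * K"
  show "(x, y) \<in> chain_step (1/2) G ^^ (g t * M * K + ?b)"
  proof (cases "\<exists>i\<in>I. x \<in> ball (a i) (R i) \<and> y \<in> ball (a i) (R i)")
    case True
    then obtain i where i: "i \<in> I" "x \<in> ball (a i) (R i)" "y \<in> ball (a i) (R i)" by blast
    have le: "t * codist G z \<le> t * infdist z (E i)" for z
      using codist_le_infdist[OF i(1)] t by (rule mult_left_mono)
    have "(x, y) \<in> chain_step (1/2) G ^^ (g t * M * K)"
      by (rule chain_inside[OF i(1) g[OF i(1)]])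
        (use x y i le[of x] le[of y] d in \<open>auto simp: G_def\<close>)
    then show ?thesis by (rule chain_pad) (use y in auto)
  next
    case False
    obtain u where u: "u \<in> closed_segment x y" "u \<in> D" "\<forall>i\<in>I. u \<notin> ball (a i) (R i)"
      "codist G x \<le> 2 / \<eta> * codist G u" "(x, u) \<in> chain_step (1/2) G ^^ (g (2*t/\<eta>) * M * K)"
      using escape_hole[OF g x y d(1) t False] by blast
    have d2: "dist y x \<le> t * codist G y" using d(2) by (simp add: dist_commute)
    have "\<not> (\<exists>i\<in>I. y \<in> ball (a i) (R i) \<and> x \<in> ball (a i) (R i))" using False by blast
    from escape_hole[OF g y x d2 t this]
    obtain v where v: "v \<in> closed_segment y x" "v \<in> D" "\<forall>i\<in>I. v \<notin> ball (a i) (R i)"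
      "codist G y \<le> 2 / \<eta> * codist G v" "(y, v) \<in> chain_step (1/2) G ^^ (g (2*t/\<eta>) * M * K)"
      by blast
    have "v \<in> closed_segment x y" using v(1) by (simp add: closed_segment_commute)
    then have duv: "dist u v \<le> dist x y"
      using u(1) by (intro dist_closed_segment_le)
    have "t * codist G x \<le> t * (2 / \<eta> * codist G u)" "t * codist G y \<le> t * (2 / \<eta> * codist G v)"
      using u(4) v(4) t by (simp_all only: mult_left_mono)
    then have "dist u v \<le> 2 * t / \<eta> * codist G u" "dist u v \<le> 2 * t / \<eta> * codist G v"
      using duv d by (auto simp: mult_ac)
    then have "(u, v) \<in> chain_step (1/2) G ^^ (f (2*t/\<eta>) * M * K)"
      using u v t \<eta> by (intro chain_outside[OF f]) auto
    then have "(x, y) \<in> chain_step (1/2) G ^^ ?b"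
      using relpow_trans[OF relpow_trans[OF u(5)] chain_sym[OF v(5)]] by blast
    then show ?thesis by (rule chain_pad) (use y in auto)
  qed
qed

end

text \<open>Here the complement is simple enough for a direct chain: \<open>x\<close> moves radially
  to the sphere through \<open>y\<close>, then along this sphere.\<close>

lemma punctured_chain_uniform:
  assumes "2 \<le> DIM('a::euclidean_space)"
  shows "\<exists>f. \<forall>a::'a. chain_uniform f (- {a})"
proof -
  obtain K where K: "\<And>(b::'a) \<rho> p q. 0 < \<rho> \<Longrightarrow> p \<in> sphere b \<rho> \<Longrightarrow> q \<in> sphere b \<rho> \<Longrightarrow>
      (p, q) \<in> sphere_step (1/2) b \<rho> ^^ K"
    using sphere_chain[OF assms, of "1/2"] by (metis half_gt_zero zero_less_one)
  show ?thesis
  proof (intro exI[of _ "\<lambda>t. Suc (nat \<lceil>2 * t\<rceil>) + K"] allI)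
    fix a :: 'a
    let ?G = "- {a}"
    have co: "codist ?G z = dist z a" for z unfolding codist_def by simp
    show "chain_uniform (\<lambda>t. Suc (nat \<lceil>2 * t\<rceil>) + K) ?G" unfolding chain_uniform_def co
    proof (intro ballI allI impI)
      fix x y t assume x: "x \<in> ?G" and y: "y \<in> ?G" and d: "dist x y \<le> t * dist x a" "dist x y \<le> t * dist y a"
      have ya: "0 < dist a y" using y by auto
      have xa: "0 < dist a x" using x by auto
      obtain p where p: "p \<in> sphere a (dist a y)" "dist x p = \<bar>dist a x - dist a y\<bar>"
        using sphere_nearest[of "dist a y" a x] by auto
      define m where "m = min (dist a x) (dist a y)"
      have m: "0 < m" unfolding m_def using xa ya by simp
      \<comment> \<open>Apply the triangle inequality from whichever end of the radial segment is
        farther from \<open>a\<close>.\<close>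
      have seg: "m \<le> dist a z" if "z \<in> closed_segment x p" for z
        using dist_in_closed_segment[OF that] p dist_triangle[of a x z] dist_triangle[of a p z]
        unfolding m_def by (auto simp: dist_commute min_def abs_if split: if_splits)
      have "dist x p \<le> dist x y" using p(2) dist_triangle[of a x y] dist_triangle[of a y x]
        by (simp add: dist_commute)
      also have "\<dots> \<le> t * m" using d unfolding m_def by (simp add: min_def dist_commute)
      \<comment> \<open>With steps of length \<open>m / 2\<close> about \<open>2 * t\<close> of them
        are needed; \<open>Suc\<close> keeps their number positive, as \<open>segment_chain\<close>
        requires.\<close>
      also have "\<dots> \<le> real (Suc (nat \<lceil>2 * t\<rceil>)) / 2 * m"
        using m real_nat_ceiling_ge[of "2 * t"] by (intro mult_right_mono) auto
      finally have dp: "dist x p \<le> real (Suc (nat \<lceil>2 * t\<rceil>)) * (m / 2)" by simp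
      have "(x, p) \<in> chain_step (1/2) ?G ^^ Suc (nat \<lceil>2 * t\<rceil>)"
      proof (rule segment_chain[OF _ dp])
        fix z w assume "z \<in> closed_segment x p" "w \<in> closed_segment x p" "dist z w \<le> m / 2"
        then show "(z, w) \<in> chain_step (1/2) ?G"
          using seg[of z] seg[of w] m unfolding chain_step_def co by (auto simp: dist_commute)
      qed simp
      moreover have "(p, y) \<in> sphere_step (1/2) a (dist a y) ^^ K"
        by (rule K[OF ya p(1)]) simp
      then have "(p, y) \<in> chain_step (1/2) ?G ^^ K"
        by (rule relpow_subset[rotated])
          (use ya in \<open>auto simp: sphere_step_def chain_step_def co dist_commute\<close>)
      ultimately show "(x, y) \<in> chain_step (1/2) ?G ^^ (Suc (nat \<lceil>2 * t\<rceil>) + K)" by (rule relpow_trans)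
    qed
  qed
qed

section \<open>The point and the sequence of sets\<close>

lemma chain_uniform_remove_point:
  fixes f :: "real \<Rightarrow> nat"
  assumes dim: "2 \<le> DIM('a::euclidean_space)"
  shows "\<exists>h. \<forall>(D::'a set) b. open D \<longrightarrow> D \<noteq> UNIV \<longrightarrow> b \<in> D \<longrightarrow> chain_uniform f D \<longrightarrow> chain_uniform h (D - {b})"
proof -
  obtain g where g: "\<And>b::'a. chain_uniform g (- {b})" using punctured_chain_uniform[OF dim] by blast
  \<comment> \<open>With \<delta> the distance from \<open>b\<close> to the complement of
    \<open>D\<close> and a hole of radius \<open>\<delta>/4\<close>, the conditions come down to
    \<open>5 * \<eta> \<le> 1\<close>. The value 1/8 makes \<open>\<eta>\<^sup>2/4\<close> equal to
    1/256, whence \<open>M\<close>.\<close>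
  define \<eta> :: real where "\<eta> = 1/8"
  obtain K where K: "1 \<le> K" "\<And>(b::'a) \<rho> p q. 0 < \<rho> \<Longrightarrow> p \<in> sphere b \<rho> \<Longrightarrow> q \<in> sphere b \<rho> \<Longrightarrow>
      (p, q) \<in> sphere_step (\<eta>/2) b \<rho> ^^ K"
    by (rule sphere_chain[OF dim, of "\<eta>/2"]) (auto simp: \<eta>_def)
  define M :: nat where "M = 256"
  show ?thesis
  proof (intro exI allI impI)
    fix D :: "'a set" and b assume D: "open D" "D \<noteq> UNIV" "b \<in> D" and f: "chain_uniform f D"
    define \<delta> where "\<delta> = codist D b"
    have \<delta>: "0 < \<delta>" unfolding \<delta>_def by (rule codist_pos[OF D])
    have co: "\<rho> \<le> codist (D - {b}) z" if "\<rho> \<le> dist z b" "\<And>w. w \<notin> D \<Longrightarrow> \<rho> \<le> dist z w" for \<rho> z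
      by (rule codist_ge) (use that D in auto)
    have far: "\<delta> \<le> dist b z + dist z w" if "w \<notin> D" for z w
      using codist_le[OF that, of b] dist_triangle[of b w z] unfolding \<delta>_def by linarith
    interpret hs: hole_system \<eta> D "{()}" "\<lambda>_. b" "\<lambda>_. \<delta>/4" "\<lambda>_. {b}" K M "D - {b}"
    proof
      show "0 < \<eta>" "\<eta> \<le> 1/2" "1 \<le> real M * (\<eta>\<^sup>2/4)"
        by (auto simp: \<eta>_def M_def power2_eq_square)
      show "cball b (\<delta>/4) \<subseteq> D"
      proof
        fix z assume "z \<in> cball b (\<delta>/4)"
        then show "z \<in> D" using far[of z z] \<delta> by (cases "z \<in> D") auto
      qed
      show "\<eta> * codist D z \<le> codist (D - {b}) z"
        if "z \<in> D" "\<And>i. i \<in> {()} \<Longrightarrow> z \<notin> ball b (\<delta>/4)" for z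
      proof (rule co)
        have "codist D z \<le> \<delta> + dist z b" unfolding \<delta>_def by (rule codist_triangle)
        then show "\<eta> * codist D z \<le> dist z b"
          using that(2) \<delta> unfolding \<eta>_def by (auto simp: dist_commute)
        show "\<eta> * codist D z \<le> dist z w" if "w \<notin> D" for w
          using codist_le[OF that, of z] codist_nonneg[of D z] unfolding \<eta>_def by linarith
      qed
      have near: "\<eta> * dist z b \<le> codist (D - {b}) z" if "z \<in> cball b (\<delta>/4)" for z
      proof (rule co)
        show "\<eta> * dist z b \<le> dist z b" unfolding \<eta>_def by simp
        show "\<eta> * dist z b \<le> dist z w" if "w \<notin> D" for w
          using far[OF that, of z] \<open>z \<in> cball b (\<delta>/4)\<close> \<delta> unfolding \<eta>_def by (simp add: dist_commute)
      qed
      then show "\<eta> * infdist z {b} \<le> codist (D - {b}) z" if "z \<in> cball b (\<delta>/4)" for z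
        using that by simp
      show "\<eta> * (\<delta>/4) \<le> codist (D - {b}) z" if "z \<in> sphere b (\<delta>/4)" for z
        using near[of z] that by (auto simp: dist_commute \<eta>_def)
      show "\<eta> * codist D z \<le> \<delta>/4" if "z \<in> ball b (\<delta>/4)" for z
        using codist_triangle[of D z b] that \<delta> unfolding \<eta>_def \<delta>_def by (simp add: dist_commute)
    qed (use D \<delta> K in auto)
    show "chain_uniform (\<lambda>t. g t * M * K + (g (2*t/\<eta>) * M * K + f (2*t/\<eta>) * M * K + g (2*t/\<eta>) * M * K)) (D - {b})"
      by (rule hs.chain_uniform_remove_holes[OF f]) (use g D in \<open>auto intro!: codist_pos open_delete\<close>)
  qed
qed

section \<open>Separation of the balls and removal of the sequence\<close>

lemma disjoint_balls_radii:
  fixes x y :: "'a::euclidean_space"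
  assumes "ball x r \<inter> ball y s = {}" "0 < r" "0 < s"
  shows "r + s \<le> dist x y"
proof (rule ccontr)
  assume *: "\<not> ?thesis"
  \<comment> \<open>The point dividing the segment in the ratio \<open>r\<close> to \<open>s\<close>
    would lie in both balls.\<close>
  define z where "z = x + (r / (r + s)) *\<^sub>R (y - x)"
  have "dist x z = r * (dist x y / (r + s))"
    unfolding z_def using assms by (simp add: dist_norm norm_minus_commute)
  moreover have "y - z = (s / (r + s)) *\<^sub>R (y - x)"
  proof -
    have e: "s / (r + s) = 1 - r / (r + s)" using assms by (simp add: field_simps)
    show ?thesis unfolding z_def e by (simp add: algebra_simps)
  qed
  then have "dist y z = s * (dist x y / (r + s))"
    using assms by (simp add: dist_norm norm_minus_commute)
  moreover have "dist x y / (r + s) < 1" using * assms by (simp add: pos_divide_less_eq)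
  then have "r * (dist x y / (r + s)) < r * 1" "s * (dist x y / (r + s)) < s * 1"
    using assms by (simp_all only: mult_strict_left_mono)
  ultimately have "z \<in> ball x r \<inter> ball y s" by simp
  then show False using assms by blast
qed

text \<open>The function \<open>f\<close> belongs to \<open>D - {x0}\<close>: with \<open>x0\<close>
  already in the complement, the balls about the \<open>x i\<close> are comparable in size to the
  distance to the complement although they shrink to \<open>x0\<close>, as \<open>size\<close> of
  the hole system demands.\<close>

lemma chain_uniform_remove_sequence:
  fixes f g :: "real \<Rightarrow> nat" and c :: real
  assumes dim: "2 \<le> DIM('a::euclidean_space)" and c: "0 < c" "c < 1"
  shows "\<exists>h. \<forall>(D::'a set) x0 x r E.
       open D \<longrightarrow> D \<noteq> UNIV \<longrightarrow> x0 \<in> D \<longrightarrow> chain_uniform f (D - {x0}) \<longrightarrow>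
       (\<forall>i\<ge>2. x i \<in> closed_segment x0 (x (i - 1))) \<longrightarrow>
       (\<forall>i\<ge>1. dist x0 (x i) = codist D x0 / 2 ^ (i + 2)) \<longrightarrow>
       (\<forall>i\<ge>1. 0 < r i) \<longrightarrow>
       disjoint_family_on (\<lambda>i. ball (x i) (r i)) {1::nat..} \<longrightarrow>
       (\<forall>i\<ge>1. closed (E i) \<and> E i \<subseteq> ball (x i) (c * r i) \<and> chain_uniform g (- E i) \<and> x i \<in> E i) \<longrightarrow>
       (let G = D - ((\<Union>i\<in>{1..}. E i) \<union> {x0}) in open G \<and> G \<noteq> {} \<and> chain_uniform h G)"
proof -
  \<comment> \<open>With 1 - c = 8 \<epsilon>, balls whose centers are L apart keep a gap of at
    least 5 \<epsilon> L: shrinking by \<open>c\<close> gains 8 \<epsilon> L, and the collars cost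
    at most 3 \<epsilon> L.\<close>
  define \<epsilon> where "\<epsilon> = (1 - c) / 8"
  have \<epsilon>: "0 < \<epsilon>" "\<epsilon> < 1/8" "c = 1 - 8 * \<epsilon>" using c unfolding \<epsilon>_def by (auto simp: field_simps)
  \<comment> \<open>The factor 1/2 absorbs the numerical constants below, all less than 2.\<close>
  define \<eta> where "\<eta> = \<epsilon> / 2"
  have \<eta>: "0 < \<eta>" "\<eta> \<le> 1/2" using \<epsilon> unfolding \<eta>_def by auto
  obtain K where K: "1 \<le> K" "\<And>(b::'a) \<rho> p q. 0 < \<rho> \<Longrightarrow> p \<in> sphere b \<rho> \<Longrightarrow> q \<in> sphere b \<rho> \<Longrightarrow>
      (p, q) \<in> sphere_step (\<eta>/2) b \<rho> ^^ K"
    by (rule sphere_chain[OF dim, of "\<eta>/2"]) (use \<eta> in auto)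
  obtain M :: nat where "1 / (\<eta>\<^sup>2/4) \<le> real M" using real_arch_simple by blast
  then have M: "1 \<le> real M * (\<eta>\<^sup>2/4)" using \<eta> by (simp add: pos_divide_le_eq)
  show ?thesis
  proof (intro exI allI impI)
    fix D :: "'a set" and x0 :: 'a and x r E
    assume D: "open D" "D \<noteq> UNIV" "x0 \<in> D" and f: "chain_uniform f (D - {x0})"
      and xseg: "\<forall>i\<ge>2. x i \<in> closed_segment x0 (x (i - 1))"
      and dx: "\<forall>i\<ge>1. dist x0 (x i) = codist D x0 / 2 ^ (i + 2)"
      and r: "\<forall>i\<ge>1. 0 < r i"
      and dis: "disjoint_family_on (\<lambda>i. ball (x i) (r i)) {1::nat..}"
      and E: "\<forall>i\<ge>1. closed (E i) \<and> E i \<subseteq> ball (x i) (c * r i) \<and> chain_uniform g (- E i) \<and> x i \<in> E i"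
    define \<delta> where "\<delta> = codist D x0"
    have \<delta>: "0 < \<delta>" unfolding \<delta>_def by (rule codist_pos[OF D])
    define s where "s i = \<delta> / 2 ^ (i + 2)" for i :: nat
    have sx: "dist x0 (x i) = s i" if "1 \<le> i" for i using dx that unfolding s_def \<delta>_def by simp
    have s0: "0 < s i" for i unfolding s_def using \<delta> by simp
    have sSuc: "s (Suc i) = s i / 2" for i unfolding s_def by simp
    have sle: "s j \<le> s i / 2" if "i < j" for i j
    proof -
      have "(2::real) ^ (Suc i + 2) \<le> 2 ^ (j + 2)" using that by (intro power_increasing) auto
      then have "s j \<le> s (Suc i)" unfolding s_def using \<delta> by (intro divide_left_mono) auto
      then show ?thesis using sSuc by simp
    qed
    have s8: "s i \<le> \<delta> / 8" if "1 \<le> i" for i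
    proof -
      have "(2::real) ^ 3 \<le> 2 ^ (i + 2)" using that by (intro power_increasing) auto
      then show ?thesis unfolding s_def using \<delta> by (intro divide_left_mono) auto
    qed
    have rr: "r i + r j \<le> dist (x i) (x j)" if "1 \<le> i" "1 \<le> j" "i \<noteq> j" for i j
      by (rule disjoint_balls_radii) (use dis r that in \<open>auto simp: disjoint_family_on_def\<close>)
    \<comment> \<open>The next center lies on the segment from \<open>x0\<close> to
      \<open>x i\<close>, halfway, so disjointness gives
      \<open>r i + r (Suc i) \<le> s i / 2\<close>.\<close>
    have rs: "r i \<le> s i / 2" if i: "1 \<le> i" for i
    proof -
      have "x (Suc i) \<in> closed_segment x0 (x i)" using xseg i by (metis Suc_1 Suc_le_mono diff_Suc_1)
      then have "dist x0 (x i) = dist x0 (x (Suc i)) + dist (x (Suc i)) (x i)"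
        using between between_mem_segment by metis
      then have "dist (x i) (x (Suc i)) = s i / 2"
        using sx[of i] sx[of "Suc i"] sSuc i by (simp add: dist_commute)
      then show ?thesis using rr[of i "Suc i"] i r by (smt (verit, ccfv_SIG) le_SucI n_not_Suc_n)
    qed
    \<comment> \<open>The ball of radius \<open>c * r i\<close> contains \<open>E i\<close>; the
      collar of width \<open>\<epsilon> * s i\<close> keeps the sphere away from \<open>E i\<close>
      on the scale of the distance to \<open>x0\<close>.\<close>
    define R where "R i = c * r i + \<epsilon> * s i" for i
    have cr: "c * r i \<le> c * (s i / 2)" if "1 \<le> i" for i using rs[OF that] c by (intro mult_left_mono) auto
    have cr0: "0 < c * r i" if "1 \<le> i" for i using r c that by simp
    have Rle: "R i \<le> s i / 2" if "1 \<le> i" for i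
    proof -
      have "R i \<le> (c / 2 + \<epsilon>) * s i" using cr[OF that] unfolding R_def by (simp add: algebra_simps)
      also have "\<dots> \<le> 1/2 * s i" using \<epsilon> s0[of i] by (intro mult_right_mono) linarith+
      finally show ?thesis by simp
    qed
    have Rge: "\<epsilon> * s i \<le> R i" if "1 \<le> i" for i using cr0[OF that] unfolding R_def by simp
    have es0: "0 < \<epsilon> * s i" for i using \<epsilon> s0 by simp
    have es8: "\<epsilon> * s i \<le> s i / 8" for i using mult_right_mono[of \<epsilon> "1/8" "s i"] \<epsilon> s0[of i] by simp
    have EinB: "dist (x i) w < c * r i" if "1 \<le> i" "w \<in> E i" for i w
      using E that by (metis mem_ball subsetD)
    have sep: "\<epsilon> * s i \<le> dist z w"
      if i: "1 \<le> i" and j: "1 \<le> j" and ij: "i \<noteq> j" and z: "z \<in> cball (x i) (R i)" and w: "w \<in> cball (x j) (R j)"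
      for i j z w
    proof -
      define L where "L = dist (x i) (x j)"
      have tri: "s i \<le> s j + L" "s j \<le> s i + L"
        using sx[OF i] sx[OF j] dist_triangle[of x0 "x i" "x j"] dist_triangle[of x0 "x j" "x i"]
        unfolding L_def by (auto simp: dist_commute)
      \<comment> \<open>The smaller of \<open>s i\<close> and \<open>s j\<close> is at most half the
        larger and they differ by at most \<open>L\<close>; so the larger is at most
        \<open>2 * L\<close>, the smaller at most \<open>L\<close>.\<close>
      have ss: "s i \<le> 2 * L" "s i + s j \<le> 3 * L"
        using tri sle[of i j] sle[of j i] s0[of i] s0[of j] ij by (cases "i < j"; force)+
      have "L \<le> R i + dist z w + R j"
        using z w dist_triangle[of "x i" "x j" z] dist_triangle[of z "x j" w] unfolding L_def
        by (simp add: dist_commute)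
      moreover have "R i + R j = c * (r i + r j) + \<epsilon> * (s i + s j)" unfolding R_def by (simp add: algebra_simps)
      moreover have "c * (r i + r j) \<le> c * L"
        using rr[OF i j ij] c unfolding L_def by (intro mult_left_mono) auto
      moreover have "\<epsilon> * (s i + s j) \<le> \<epsilon> * (3 * L)" using ss \<epsilon> by (intro mult_left_mono) auto
      moreover have "c * L = L - 8 * (\<epsilon> * L)" unfolding \<epsilon>(3) by (simp add: algebra_simps)
      moreover have "\<epsilon> * s i \<le> \<epsilon> * (2 * L)" using ss \<epsilon> by (intro mult_left_mono) auto
      moreover have "0 \<le> \<epsilon> * L" unfolding L_def using \<epsilon> by simp
      ultimately show ?thesis by linarith
    qed
    let ?D = "D - {x0}"
    define G where "G = ?D - (\<Union>i\<in>{1..}. E i)"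
    have Geq: "D - ((\<Union>i\<in>{1..}. E i) \<union> {x0}) = G" unfolding G_def by blast
    have GU: "G \<noteq> UNIV" unfolding G_def by blast
    have x0d: "codist ?D z \<le> dist z x0" for z by (rule codist_le) simp
    have zx0: "s i / 2 \<le> dist x0 z" "dist x0 z \<le> 3/2 * s i" if "1 \<le> i" "z \<in> cball (x i) (R i)" for i z
      using that Rle[of i] sx[of i] dist_triangle[of x0 "x i" z] dist_triangle[of x0 z "x i"]
      by (auto simp: dist_commute)
    \<comment> \<open>Apart from \<open>E i\<close>, the complement of \<open>G\<close> consists of
      the complement of \<open>D\<close>, the point \<open>x0\<close> and the other
      \<open>E j\<close>; each keeps this distance from the closed ball.\<close>
    have other: "\<epsilon> * s i \<le> dist z w" if i: "1 \<le> i" and z: "z \<in> cball (x i) (R i)" and w: "w \<notin> G" "w \<notin> E i" for i z w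
    proof -
      consider "w \<notin> D" | "w = x0" | j where "1 \<le> j" "w \<in> E j" using w(1) unfolding G_def by auto
      then show ?thesis
      proof cases
        case 1
        have "\<delta> \<le> dist x0 z + dist z w"
          using codist_le[OF 1, of x0] dist_triangle[of x0 w z] unfolding \<delta>_def by linarith
        then show ?thesis using zx0[OF i z] s8[OF i] es8[of i] s0[of i] by linarith
      next
        case 2
        show ?thesis unfolding 2 dist_commute[of z] using zx0[OF i z] es8[of i] s0[of i] by linarith
      next
        case 3
        have "w \<in> cball (x j) (R j)" using EinB[OF 3] es0[of j] unfolding R_def by simp
        then show ?thesis using sep[OF i 3(1) _ z] 3 w(2) by metis
      qed
    qed
    have sphere_ge: "\<epsilon> * s i \<le> codist G z" if i: "1 \<le> i" and z: "z \<in> sphere (x i) (R i)" for i z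
    proof (rule codist_ge[OF GU])
      fix w assume w: "w \<notin> G"
      show "\<epsilon> * s i \<le> dist z w"
      proof (cases "w \<in> E i")
        case True
        then show ?thesis using EinB[OF i True] z dist_triangle[of "x i" z w] unfolding R_def
          by (simp add: dist_commute)
      next
        case False
        then show ?thesis using other[OF i _ w] z by auto
      qed
    qed
    interpret hs: hole_system \<eta> ?D "{1..}" x R E K M G
    proof
      show "0 < \<eta>" "\<eta> \<le> 1/2" using \<eta> by auto
      show "1 \<le> real M * (\<eta>\<^sup>2/4)" by (rule M)
      show "G = ?D - (\<Union>i\<in>{1..}. E i)" by (rule G_def)
      show "0 < R i" if "i \<in> {1..}" for i using Rge[of i] es0[of i] that by simp
      show "E i \<noteq> {}" if "i \<in> {1..}" for i using E that by auto
      show "E i \<subseteq> ball (x i) (R i)" if "i \<in> {1..}" for i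
        using EinB[of i] es0[of i] that unfolding R_def by force
      show "cball (x i) (R i) \<subseteq> ?D" if "i \<in> {1..}" for i
      proof
        fix z assume z: "z \<in> cball (x i) (R i)"
        have "\<delta> \<le> dist x0 z" if "z \<notin> D" using codist_le[OF that, of x0] unfolding \<delta>_def .
        then show "z \<in> ?D" using zx0[OF _ z] s8[of i] s0[of i] \<delta> \<open>i \<in> {1..}\<close> by force
      qed
      \<comment> \<open>For \<open>w\<close> in \<open>E i\<close> the collar gives
        \<open>\<epsilon> * s i \<le> dist z w\<close>. As \<open>w\<close> is within
        \<open>3/2 * s i\<close> of \<open>x0\<close>, the distance from \<open>z\<close> to
        \<open>x0\<close>, which bounds \<open>codist ?D z\<close>, is at most
        \<open>dist z w / \<eta>\<close>.\<close>
      show "\<eta> * codist ?D z \<le> codist G z" if z: "z \<in> ?D" "\<And>i. i \<in> {1..} \<Longrightarrow> z \<notin> ball (x i) (R i)" for z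
      proof (rule codist_ge[OF GU])
        fix w assume w: "w \<notin> G"
        show "\<eta> * codist ?D z \<le> dist z w"
        proof (cases "w \<in> ?D")
          case False
          have "\<eta> * codist ?D z \<le> 1 * codist ?D z" using \<eta> by (intro mult_right_mono) auto
          then show ?thesis using codist_le[OF False, of z] by linarith
        next
          case True
          then obtain i where i: "1 \<le> i" "w \<in> E i" using w unfolding G_def by auto
          have zi: "R i \<le> dist (x i) z" using z(2)[of i] i by simp
          have tri: "dist (x i) z \<le> dist z w + c * r i"
            using EinB[OF i] dist_triangle[of "x i" z w] by (simp add: dist_commute)
          have 1: "\<epsilon> * s i \<le> dist z w" using zi tri unfolding R_def by simp
          have "c * r i \<le> 1 * (s i / 2)"
            using rs[OF i(1)] c r i by (intro mult_mono) auto
          then have "dist z x0 \<le> dist z w + 3/2 * s i"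
            using tri sx[OF i(1)] dist_triangle[of z x0 "x i"] by (simp add: dist_commute)
          then have "\<epsilon> * dist z x0 \<le> \<epsilon> * (dist z w + 3/2 * s i)" using \<epsilon> by (intro mult_left_mono) auto
          also have "\<dots> = \<epsilon> * dist z w + 3/2 * (\<epsilon> * s i)" by (simp add: algebra_simps)
          also have "\<dots> \<le> 1/8 * dist z w + 3/2 * dist z w"
            using 1 \<epsilon> by (intro add_mono mult_right_mono) auto
          finally have "\<epsilon> * dist z x0 / 2 \<le> dist z w" using zero_le_dist[of z w] by linarith
          then have "\<eta> * dist z x0 \<le> dist z w" unfolding \<eta>_def by simp
          moreover have "\<eta> * codist ?D z \<le> \<eta> * dist z x0" using x0d \<eta> by (intro mult_left_mono) auto
          ultimately show ?thesis by linarith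
        qed
      qed
      show "\<eta> * infdist z (E i) \<le> codist G z"
        if i: "i \<in> {1..}" and z: "z \<in> cball (x i) (R i)" "z \<notin> E i" for i z
      proof (rule codist_ge[OF GU])
        fix w assume w: "w \<notin> G"
        have i1: "1 \<le> i" using i by simp
        show "\<eta> * infdist z (E i) \<le> dist z w"
        proof (cases "w \<in> E i")
          case True
          have "\<eta> * infdist z (E i) \<le> 1 * infdist z (E i)" using \<eta> by (intro mult_right_mono infdist_nonneg) auto
          then show ?thesis using infdist_le[OF True, of z] by linarith
        next
          case False
          have "infdist z (E i) \<le> dist z (x i)" using E i by (intro infdist_le) auto
          also have "\<dots> \<le> s i" using z(1) Rle[OF i1] s0[of i] by (simp add: dist_commute)
          finally have "\<eta> * infdist z (E i) \<le> \<eta> * s i" using \<eta> by (intro mult_left_mono) auto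
          also have "\<dots> \<le> \<epsilon> * s i" using \<epsilon> s0[of i] unfolding \<eta>_def by simp
          finally show ?thesis using other[OF i1 z(1) w False] by linarith
        qed
      qed
      have eR: "\<eta> * R i \<le> \<epsilon> * s i" if "1 \<le> i" for i
      proof -
        have "\<eta> * R i \<le> \<eta> * s i" using Rle[OF that] s0[of i] \<eta> by (intro mult_left_mono) auto
        also have "\<dots> \<le> \<epsilon> * s i" using \<epsilon> s0[of i] unfolding \<eta>_def by simp
        finally show ?thesis .
      qed
      show "\<eta> * R i \<le> codist G z" if "i \<in> {1..}" "z \<in> sphere (x i) (R i)" for i z
        using eR[of i] sphere_ge[of i z] that by auto
      show "\<eta> * codist ?D z \<le> R i" if i: "i \<in> {1..}" and z: "z \<in> ball (x i) (R i)" for i z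
      proof -
        have "codist ?D z \<le> 3/2 * s i" using x0d[of z] zx0(2)[of i z] i z by (auto simp: dist_commute)
        then have "\<eta> * codist ?D z \<le> \<eta> * (3/2 * s i)" using \<eta> by (intro mult_left_mono) auto
        also have "\<dots> \<le> \<epsilon> * s i" using \<epsilon> s0[of i] unfolding \<eta>_def by simp
        finally show ?thesis using Rge[of i] i by simp
      qed
      show "\<eta> * R i \<le> dist z w" if "i \<in> {1..}" "j \<in> {1..}" "i \<noteq> j" "z \<in> cball (x i) (R i)" "w \<in> cball (x j) (R j)"
        for i j z w using sep[of i j z w] eR[of i] that by simp
    qed (use D K in auto)
    \<comment> \<open>An infinite union of closed sets need not be closed. That \<open>G\<close> is
      open follows from a positive distance to the complement, which the hole system gives: by
      \<open>inside\<close> in the balls, by \<open>outside\<close> elsewhere.\<close>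
    have pos: "0 < codist G z" if z: "z \<in> G" for z
    proof (cases "\<exists>i\<in>{1..}. z \<in> ball (x i) (R i)")
      case True
      then obtain i where i: "i \<in> {1..}" "z \<in> ball (x i) (R i)" by blast
      have zE: "z \<notin> E i" using z i unfolding G_def by blast
      have "closed (E i)" "E i \<noteq> {}" using E i by auto
      then have "infdist z (E i) \<noteq> 0" using zE in_closed_iff_infdist_zero by blast
      then have "0 < \<eta> * infdist z (E i)" using infdist_nonneg[of z "E i"] \<eta> by simp
      then show ?thesis using hs.inside[OF i(1) _ zE] i(2) by force
    next
      case False
      have "z \<in> ?D" using z unfolding G_def by blast
      then have "\<eta> * codist ?D z \<le> codist G z" "0 < codist ?D z"
        using False D by (auto intro!: hs.outside codist_pos)
      then show ?thesis using \<eta> by (meson less_le_trans mult_pos_pos)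
    qed
    have "open G" unfolding open_contains_ball
    proof
      fix z assume "z \<in> G"
      have "ball z (codist G z) \<subseteq> G" using codist_le[of _ G z] by force
      then show "\<exists>e>0. ball z e \<subseteq> G" using pos[OF \<open>z \<in> G\<close>] by blast
    qed
    moreover have "G \<noteq> {}"
    proof -
      obtain p where "p \<in> sphere (x 1) (R 1)" using sphere_nearest[of "R 1" "x 1" x0] hs.R[of 1] by auto
      then show ?thesis using hs.sphere_in_G(1)[of 1 p] by auto
    qed
    moreover have "chain_uniform (\<lambda>t. g t * M * K + (g (2*t/\<eta>) * M * K + f (2*t/\<eta>) * M * K + g (2*t/\<eta>) * M * K)) G"
      by (rule hs.chain_uniform_remove_holes[OF f]) (use E pos in auto)
    ultimately show "let G = D - ((\<Union>i\<in>{1..}. E i) \<union> {x0}) in open G \<and> G \<noteq> {} \<and>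
      chain_uniform (\<lambda>t. g t * M * K + (g (2*t/\<eta>) * M * K + f (2*t/\<eta>) * M * K + g (2*t/\<eta>) * M * K)) G"
      unfolding Geq Let_def by blast
  qed
qed

theorem theorem4p23:
  fixes \<phi> \<psi> :: "real \<Rightarrow> real" and c :: real
  assumes "CARD('n::finite) \<ge> 2"
    and "halfline_homeo \<phi>" and "halfline_homeo \<psi>"
    and "0 < c" and "c < 1"
  shows "\<exists>\<phi>\<^sub>3. halfline_homeo \<phi>\<^sub>3 \<and>
    (\<forall>(D :: (real ^ 'n) set) (x\<^sub>0 :: real ^ 'n) (x :: nat \<Rightarrow> real ^ 'n) (r :: nat \<Rightarrow> real)
        (E :: nat \<Rightarrow> (real ^ 'n) set).
       uniform_domain \<phi> D \<and> x\<^sub>0 \<in> D \<and>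
       (\<forall>i\<ge>1. x i \<in> ball x\<^sub>0 (bdist D x\<^sub>0)) \<and>
       (\<forall>i\<ge>2. x i \<in> half_open_segment x\<^sub>0 (x (i - 1))) \<and>
       (\<forall>i\<ge>1. dist x\<^sub>0 (x i) = 1 / 2 ^ (i + 2) * bdist D x\<^sub>0) \<and>
       (\<forall>i\<ge>1. 0 < r i) \<and>
       disjoint_family_on (\<lambda>i. ball (x i) (r i)) {1..} \<and>
       (\<forall>i\<ge>1. closed (E i) \<and> E i \<subseteq> ball (x i) (c * r i) \<and>
          uniform_domain \<psi> (- E i) \<and> x i \<in> E i)
       \<longrightarrow> uniform_domain \<phi>\<^sub>3 (D - ((\<Union>i\<in>{1..}. E i) \<union> {x\<^sub>0})))"
proof -
  have dim: "2 \<le> DIM(real ^ 'n)" using assms(1) by simp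
  \<comment> \<open>All counting functions are obtained before \<open>D\<close>,
    \<open>x\<^sub>0\<close> and the \<open>E i\<close> are fixed: \<open>f\<close> from \<phi>,
    \<open>g\<close> from \<psi>, then \<open>f'\<close> for the punctured domain and
    \<open>h\<close> for the final set. So \<open>\<phi>\<^sub>3\<close> depends only on \<phi>,
    \<psi>, \<open>c\<close> and the dimension.\<close>
  obtain f where f: "\<And>G::(real ^ 'n) set. uniform_domain \<phi> G \<Longrightarrow> chain_uniform f G"
    using uniform_imp_chain_uniform[OF assms(2)] by blast
  obtain g where g: "\<And>G::(real ^ 'n) set. uniform_domain \<psi> G \<Longrightarrow> chain_uniform g G"
    using uniform_imp_chain_uniform[OF assms(3)] by blast
  obtain f' where f': "\<And>(D::(real ^ 'n) set) b. open D \<Longrightarrow> D \<noteq> UNIV \<Longrightarrow> b \<in> D \<Longrightarrow>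
      chain_uniform f D \<Longrightarrow> chain_uniform f' (D - {b})"
    using chain_uniform_remove_point[OF dim] by blast
  obtain h where h: "\<forall>(D::(real ^ 'n) set) x0 x r E.
       open D \<longrightarrow> D \<noteq> UNIV \<longrightarrow> x0 \<in> D \<longrightarrow> chain_uniform f' (D - {x0}) \<longrightarrow>
       (\<forall>i\<ge>2. x i \<in> closed_segment x0 (x (i - 1))) \<longrightarrow>
       (\<forall>i\<ge>1. dist x0 (x i) = codist D x0 / 2 ^ (i + 2)) \<longrightarrow>
       (\<forall>i\<ge>1. 0 < r i) \<longrightarrow>
       disjoint_family_on (\<lambda>i. ball (x i) (r i)) {1::nat..} \<longrightarrow>
       (\<forall>i\<ge>1. closed (E i) \<and> E i \<subseteq> ball (x i) (c * r i) \<and> chain_uniform g (- E i) \<and> x i \<in> E i) \<longrightarrow>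
       (let G = D - ((\<Union>i\<in>{1..}. E i) \<union> {x0}) in open G \<and> G \<noteq> {} \<and> chain_uniform h G)"
    using chain_uniform_remove_sequence[OF dim assms(4,5)] by blast
  obtain \<phi>\<^sub>3 where \<phi>\<^sub>3: "halfline_homeo \<phi>\<^sub>3" "\<And>G::(real ^ 'n) set. open G \<Longrightarrow> G \<noteq> {} \<Longrightarrow> G \<noteq> UNIV \<Longrightarrow>
      chain_uniform h G \<Longrightarrow> uniform_domain \<phi>\<^sub>3 G"
    using chain_uniform_imp_uniform by blast
  show ?thesis
  proof (intro exI[of _ \<phi>\<^sub>3] conjI allI impI \<phi>\<^sub>3(1); elim conjE)
    fix D :: "(real ^ 'n) set" and x\<^sub>0 x r E
    assume D: "uniform_domain \<phi> D" "x\<^sub>0 \<in> D"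
      and x: "\<forall>i\<ge>2. x i \<in> half_open_segment x\<^sub>0 (x (i - 1))"
        "\<forall>i\<ge>1. dist x\<^sub>0 (x i) = 1 / 2 ^ (i + 2) * bdist D x\<^sub>0"
      and r: "\<forall>i\<ge>1. 0 < r i" "disjoint_family_on (\<lambda>i. ball (x i) (r i)) {1..}"
      and E: "\<forall>i\<ge>1. closed (E i) \<and> E i \<subseteq> ball (x i) (c * r i) \<and> uniform_domain \<psi> (- E i) \<and> x i \<in> E i"
    have oD: "open D" "D \<noteq> UNIV" using D unfolding uniform_domain_def domain_def by auto
    let ?G = "D - ((\<Union>i\<in>{1..}. E i) \<union> {x\<^sub>0})"
    have "chain_uniform f' (D - {x\<^sub>0})" by (intro f' f oD D)
    moreover have "\<forall>i\<ge>2. x i \<in> closed_segment x\<^sub>0 (x (i - 1))"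
      using x(1) unfolding half_open_segment_def by blast
    moreover have "\<forall>i\<ge>1. dist x\<^sub>0 (x i) = codist D x\<^sub>0 / 2 ^ (i + 2)"
      using x(2) bdist_eq_codist[OF oD(1) D(2) oD(2)] by simp
    moreover have "\<forall>i\<ge>1. closed (E i) \<and> E i \<subseteq> ball (x i) (c * r i) \<and> chain_uniform g (- E i) \<and> x i \<in> E i"
      using E g by blast
    ultimately have "open ?G \<and> ?G \<noteq> {} \<and> chain_uniform h ?G"
      using h[rule_format, of D x\<^sub>0 x r E] oD D(2) r unfolding Let_def by blast
    then show "uniform_domain \<phi>\<^sub>3 ?G" by (intro \<phi>\<^sub>3(2)) blast+
  qed
qed

end
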